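(* Let $\mathcal{E}$ be a Frobenius category with triangulated quotient $\mathcal{T}$, and let $\mathcal{R}$ be a class of objects in $\mathcal{E}$. Suppose that the following hypotheses are satisfied: (i) $\mathcal{R}$ is a precovering class in $\mathcal{E}$, and every $\mathcal{R}$-precover in $\mathcal{E}$ has a kernel in $\mathcal{E}$; (ii) $\mathcal{R}$ is closed under shifts in $\mathcal{T}$; (iii) for all $R$ in $\mathcal{R}$ the injective hull $I(R)$ is in $\mathcal{R}$. Let $X$ be an object of $\mathcal{E}$ of finite $\mathcal{R}$-dimension $d$, and let $L_0$ be the object of $\mathcal{T}$ constructed from an $\mathcal{R}$-resolution of $X$ of length $d$ by the homotopy approximation construction described in the context. Then there is an isomorphism $(R,L_0)_{\mathcal{T}}\cong (R,X)_{\mathcal{T}}$ for all $R$ in $\mathcal{R}$.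
   Context: A Frobenius category is an exact category $\mathcal{E}$ with enough projectives and enough injectives in which the projective and injective objects coincide; $\mathcal{P}$ denotes the class of these objects and $\mathcal{T}=\mathcal{E}/\mathcal{P}$ the (stable) quotient category, which has the same objects as $\mathcal{E}$ and is triangulated. Each object $R$ comes with a conflation $R\to I(R)\to R[1]$ with $I(R)$ injective (the "injective hull"), and this gives the shift $R[1]$ in $\mathcal{T}$. $(A,B)_{\mathcal{T}}$ denotes $\mathrm{Hom}_{\mathcal{T}}(A,B)$. Precovers: a class $\mathcal{R}$ of objects of $\mathcal{E}$ is precovering (contravariantly finite) if for each object $X$ of $\mathcal{E}$ there is a (not necessarily unique) morphism $R_X\to X$ in $\mathcal{E}$ with $R_X\in\mathcal{R}$, called a precover, such that every morphism in $\mathcal{E}$ from an object of $\mathcal{R}$ to $X$ factors in $\mathcal{E}$ through $R_X\to X$. Resolutions and dimension: an $\mathcal{R}$-resolution of $X$ is obtained by setting $K_0=X$ and, inductively, choosing a precover $R_i\to K_i$ with kernel $K_{i+1}\to R_i$ in $\mathcal{E}$ (the sequences $K_{i+1}\to R_i\to K_i$ are not required to be conflations). If $K_d\in\mathcal{R}$ for some $d$, then $X$ has finite $\mathcal{R}$-dimension, and if $d$ is minimal with this property $X$ has $\mathcal{R}$-dimension $d$; in that case one truncates the resolution by taking $R_d=K_d$. Homotopy approximation: given such a resolution with $R_d=K_d\in\mathcal{R}$, set $L_d=R_d$ and $\ell_d=\mathrm{id}:L_d\to K_d$. Given $\ell_i:L_i\to K_i$ in $\mathcal{T}$ with $i\ge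 1$, let $\epsilon_i$ be the composite $L_i\xrightarrow{\ell_i}K_i\to R_{i-1}$ in $\mathcal{T}$, complete it to a distinguished triangle $L_i\xrightarrow{\epsilon_i}R_{i-1}\to L_{i-1}\to L_i[1]$, and, since the composite $L_i\to R_{i-1}\to K_{i-1}$ is zero, choose $\ell_{i-1}:L_{i-1}\to K_{i-1}$ completing the maps $L_i\to 0$ and $R_{i-1}\to K_{i-1}$ to a morphism of triangles to $0\to K_{i-1}\xrightarrow{=}K_{i-1}\to 0$. Iterating yields $L_0$ together with a morphism $L_0\to K_0=X$ in $\mathcal{T}$. *)

theory Defs
  imports "HOL-Algebra.Coset"
begin

section \<open>Additive categories\<close>

text \<open>Composition and addition are only meaningful on composable, respectively parallel, arrows.\<close>

record ('o, 'm) category_data =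
  Obj :: "'o set"
  Arr :: "'m set"
  Src :: "'m \<Rightarrow> 'o"
  Tgt :: "'m \<Rightarrow> 'o"
  Idn :: "'o \<Rightarrow> 'm"
  Cmp :: "'m \<Rightarrow> 'm \<Rightarrow> 'm"  (infixr "\<cdot>\<index>" 70)
  Add :: "'m \<Rightarrow> 'm \<Rightarrow> 'm"
  Zer :: "'o \<Rightarrow> 'o \<Rightarrow> 'm"

definition homs :: "('o, 'm, 'z) category_data_scheme \<Rightarrow> 'o \<Rightarrow> 'o \<Rightarrow> 'm set" where
  "homs C A B = {f \<in> Arr C. Src C f = A \<and> Tgt C f = B}"

text \<open>The additive group of morphisms, as a group of HOL-Algebra (hence written
  multiplicatively: its product is \<open>Add\<close> and its unit is the zero morphism).\<close>

definition hom_group :: "('o, 'm, 'z) category_data_scheme \<Rightarrow> 'o \<Rightarrow> 'o \<Rightarrow> 'm monoid" where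
  "hom_group C A B = \<lparr>carrier = homs C A B, monoid.mult = Add C, one = Zer C A B\<rparr>"

definition zero_object :: "('o, 'm, 'z) category_data_scheme \<Rightarrow> 'o \<Rightarrow> bool" where
  "zero_object C Z \<longleftrightarrow> Z \<in> Obj C \<and>
     (\<forall>A \<in> Obj C. (\<exists>!f. f \<in> homs C A Z) \<and> (\<exists>!f. f \<in> homs C Z A))"

definition isomorphism :: "('o, 'm, 'z) category_data_scheme \<Rightarrow> 'm \<Rightarrow> bool" where
  "isomorphism C f \<longleftrightarrow> f \<in> Arr C \<and>
     (\<exists>g \<in> homs C (Tgt C f) (Src C f).
        g \<cdot>\<^bsub>C\<^esub> f = Idn C (Src C f) \<and> f \<cdot>\<^bsub>C\<^esub> g = Idn C (Tgt C f))"

definition isomorphic :: "('o, 'm, 'z) category_data_scheme \<Rightarrow> 'o \<Rightarrow> 'o \<Rightarrow> bool" where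
  "isomorphic C A B \<longleftrightarrow> (\<exists>f \<in> homs C A B. isomorphism C f)"

locale preadditive_category =
  fixes C (structure)
  assumes src_obj: "f \<in> Arr C \<Longrightarrow> Src C f \<in> Obj C"
    and tgt_obj: "f \<in> Arr C \<Longrightarrow> Tgt C f \<in> Obj C"
    and idn_hom: "A \<in> Obj C \<Longrightarrow> Idn C A \<in> homs C A A"
    and cmp_hom: "\<lbrakk>f \<in> homs C A B; g \<in> homs C B D\<rbrakk> \<Longrightarrow> g \<cdot> f \<in> homs C A D"
    and cmp_assoc: "\<lbrakk>f \<in> homs C A B; g \<in> homs C B D; h \<in> homs C D F\<rbrakk>
                      \<Longrightarrow> (h \<cdot> g) \<cdot> f = h \<cdot> (g \<cdot> f)"
    and cmp_idn: "f \<in> homs C A B \<Longrightarrow> f \<cdot> Idn C A = f"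
    and idn_cmp: "f \<in> homs C A B \<Longrightarrow> Idn C B \<cdot> f = f"
    and hom_comm_group: "\<lbrakk>A \<in> Obj C; B \<in> Obj C\<rbrakk> \<Longrightarrow> comm_group (hom_group C A B)"
    and cmp_add_left: "\<lbrakk>f \<in> homs C A B; g \<in> homs C B D; h \<in> homs C B D\<rbrakk>
                      \<Longrightarrow> Add C g h \<cdot> f = Add C (g \<cdot> f) (h \<cdot> f)"
    and cmp_add_right: "\<lbrakk>f \<in> homs C A B; g \<in> homs C A B; h \<in> homs C B D\<rbrakk>
                      \<Longrightarrow> h \<cdot> Add C f g = Add C (h \<cdot> f) (h \<cdot> g)"

locale additive_category = preadditive_category +
  assumes ex_zero_object: "\<exists>Z. zero_object C Z"
    and ex_biproduct: "\<lbrakk>A \<in> Obj C; B \<in> Obj C\<rbrakk> \<Longrightarrow>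
          \<exists>S \<in> Obj C. \<exists>i \<in> homs C A S. \<exists>j \<in> homs C B S. \<exists>p \<in> homs C S A. \<exists>q \<in> homs C S B.
            p \<cdot> i = Idn C A \<and> q \<cdot> j = Idn C B \<and>
            p \<cdot> j = Zer C B A \<and> q \<cdot> i = Zer C A B \<and>
            Add C (i \<cdot> p) (j \<cdot> q) = Idn C S"

definition is_kernel :: "('o, 'm, 'z) category_data_scheme \<Rightarrow> 'm \<Rightarrow> 'm \<Rightarrow> bool" where
  "is_kernel C f k \<longleftrightarrow> f \<in> Arr C \<and> k \<in> Arr C \<and> Tgt C k = Src C f \<and>
     f \<cdot>\<^bsub>C\<^esub> k = Zer C (Src C k) (Tgt C f) \<and>
     (\<forall>X \<in> Obj C. \<forall>g \<in> homs C X (Src C f). f \<cdot>\<^bsub>C\<^esub> g = Zer C X (Tgt C f) \<longrightarrow>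
        (\<exists>!h. h \<in> homs C X (Src C k) \<and> k \<cdot>\<^bsub>C\<^esub> h = g))"

definition is_cokernel :: "('o, 'm, 'z) category_data_scheme \<Rightarrow> 'm \<Rightarrow> 'm \<Rightarrow> bool" where
  "is_cokernel C f c \<longleftrightarrow> f \<in> Arr C \<and> c \<in> Arr C \<and> Src C c = Tgt C f \<and>
     c \<cdot>\<^bsub>C\<^esub> f = Zer C (Src C f) (Tgt C c) \<and>
     (\<forall>X \<in> Obj C. \<forall>g \<in> homs C (Tgt C f) X. g \<cdot>\<^bsub>C\<^esub> f = Zer C (Src C f) X \<longrightarrow>
        (\<exists>!h. h \<in> homs C (Tgt C c) X \<and> h \<cdot>\<^bsub>C\<^esub> c = g))"

text \<open>\<open>is_pushout C f g i j\<close> and \<open>is_pullback C i j f g\<close> both refer to a commutative square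
  \<open>i \<cdot> f = j \<cdot> g\<close>; in the first the span \<open>(f, g)\<close>, in the second the cospan \<open>(i, j)\<close> is given.\<close>

definition is_pushout ::
  "('o, 'm, 'z) category_data_scheme \<Rightarrow> 'm \<Rightarrow> 'm \<Rightarrow> 'm \<Rightarrow> 'm \<Rightarrow> bool" where
  "is_pushout C f g i j \<longleftrightarrow> f \<in> Arr C \<and> g \<in> Arr C \<and> i \<in> Arr C \<and> j \<in> Arr C \<and>
     Src C f = Src C g \<and> Src C i = Tgt C f \<and> Src C j = Tgt C g \<and> Tgt C i = Tgt C j \<and>
     i \<cdot>\<^bsub>C\<^esub> f = j \<cdot>\<^bsub>C\<^esub> g \<and>
     (\<forall>X \<in> Obj C. \<forall>a \<in> homs C (Tgt C f) X. \<forall>b \<in> homs C (Tgt C g) X.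
        a \<cdot>\<^bsub>C\<^esub> f = b \<cdot>\<^bsub>C\<^esub> g \<longrightarrow>
        (\<exists>!h. h \<in> homs C (Tgt C i) X \<and> h \<cdot>\<^bsub>C\<^esub> i = a \<and> h \<cdot>\<^bsub>C\<^esub> j = b))"

definition is_pullback ::
  "('o, 'm, 'z) category_data_scheme \<Rightarrow> 'm \<Rightarrow> 'm \<Rightarrow> 'm \<Rightarrow> 'm \<Rightarrow> bool" where
  "is_pullback C i j f g \<longleftrightarrow> f \<in> Arr C \<and> g \<in> Arr C \<and> i \<in> Arr C \<and> j \<in> Arr C \<and>
     Src C f = Src C g \<and> Src C i = Tgt C f \<and> Src C j = Tgt C g \<and> Tgt C i = Tgt C j \<and>
     i \<cdot>\<^bsub>C\<^esub> f = j \<cdot>\<^bsub>C\<^esub> g \<and>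
     (\<forall>X \<in> Obj C. \<forall>a \<in> homs C X (Src C i). \<forall>b \<in> homs C X (Src C j).
        i \<cdot>\<^bsub>C\<^esub> a = j \<cdot>\<^bsub>C\<^esub> b \<longrightarrow>
        (\<exists>!h. h \<in> homs C X (Src C f) \<and> f \<cdot>\<^bsub>C\<^esub> h = a \<and> g \<cdot>\<^bsub>C\<^esub> h = b))"

section \<open>Exact and Frobenius categories\<close>

text \<open>Exact categories in the sense of Quillen, with the axioms as in Buehler's survey
  ``Exact categories''. The conflations are given as a set of pairs (inflation, deflation).\<close>

record ('o, 'm) exact_data = "('o, 'm) category_data" +
  Confl :: "('m \<times> 'm) set"

definition inflation :: "('o, 'm, 'z) exact_data_scheme \<Rightarrow> 'm \<Rightarrow> bool" where
  "inflation E i \<longleftrightarrow> (\<exists>p. (i, p) \<in> Confl E)"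

definition deflation :: "('o, 'm, 'z) exact_data_scheme \<Rightarrow> 'm \<Rightarrow> bool" where
  "deflation E p \<longleftrightarrow> (\<exists>i. (i, p) \<in> Confl E)"

locale exact_category = additive_category E for E (structure) +
  assumes confl_kernel: "(i, p) \<in> Confl E \<Longrightarrow> is_kernel E p i"
    and confl_cokernel: "(i, p) \<in> Confl E \<Longrightarrow> is_cokernel E i p"
    and confl_iso:
      "\<lbrakk>(i, p) \<in> Confl E; i' \<in> Arr E; p' \<in> Arr E; Tgt E i' = Src E p';
        a \<in> homs E (Src E i) (Src E i'); isomorphism E a;
        b \<in> homs E (Tgt E i) (Tgt E i'); isomorphism E b;
        c \<in> homs E (Tgt E p) (Tgt E p'); isomorphism E c;
        b \<cdot> i = i' \<cdot> a; c \<cdot> p = p' \<cdot> b\<rbrakk> \<Longrightarrow> (i', p') \<in> Confl E"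
    and idn_inflation: "A \<in> Obj E \<Longrightarrow> inflation E (Idn E A)"
    and idn_deflation: "A \<in> Obj E \<Longrightarrow> deflation E (Idn E A)"
    and cmp_inflation: "\<lbrakk>inflation E i; inflation E j; Src E j = Tgt E i\<rbrakk> \<Longrightarrow> inflation E (j \<cdot> i)"
    and cmp_deflation: "\<lbrakk>deflation E p; deflation E q; Src E q = Tgt E p\<rbrakk> \<Longrightarrow> deflation E (q \<cdot> p)"
    and pushout_inflation:
      "\<lbrakk>inflation E i; f \<in> Arr E; Src E f = Src E i\<rbrakk>
        \<Longrightarrow> \<exists>g j. is_pushout E i f g j \<and> inflation E j"
    and pullback_deflation:
      "\<lbrakk>deflation E p; f \<in> Arr E; Tgt E f = Tgt E p\<rbrakk>
        \<Longrightarrow> \<exists>g q. is_pullback E p f g q \<and> deflation E q"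

definition projective :: "('o, 'm, 'z) exact_data_scheme \<Rightarrow> 'o \<Rightarrow> bool" where
  "projective E P \<longleftrightarrow> P \<in> Obj E \<and>
     (\<forall>p f. deflation E p \<and> f \<in> homs E P (Tgt E p) \<longrightarrow>
        (\<exists>g \<in> homs E P (Src E p). p \<cdot>\<^bsub>E\<^esub> g = f))"

definition injective :: "('o, 'm, 'z) exact_data_scheme \<Rightarrow> 'o \<Rightarrow> bool" where
  "injective E J \<longleftrightarrow> J \<in> Obj E \<and>
     (\<forall>i f. inflation E i \<and> f \<in> homs E (Src E i) J \<longrightarrow>
        (\<exists>g \<in> homs E (Tgt E i) J. g \<cdot>\<^bsub>E\<^esub> i = f))"

locale frobenius_category = exact_category +
  assumes enough_projectives: "A \<in> Obj E \<Longrightarrow> \<exists>p. deflation E p \<and> projective E (Src E p) \<and> Tgt E p = A"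
    and enough_injectives: "A \<in> Obj E \<Longrightarrow> \<exists>i. inflation E i \<and> Src E i = A \<and> injective E (Tgt E i)"
    and projective_iff_injective: "projective E A \<longleftrightarrow> injective E A"

text \<open>A choice, for every object \<open>A\<close>, of a conflation \<open>A \<rightarrow> I(A) \<rightarrow> A[1]\<close> with \<open>I(A)\<close> injective.\<close>

record ('o, 'm) hulled_data = "('o, 'm) exact_data" +
  Inc :: "'o \<Rightarrow> 'm"
  Prj :: "'o \<Rightarrow> 'm"

definition hull :: "('o, 'm, 'z) hulled_data_scheme \<Rightarrow> 'o \<Rightarrow> 'o" where
  "hull E A = Tgt E (Inc E A)"

definition shift :: "('o, 'm, 'z) hulled_data_scheme \<Rightarrow> 'o \<Rightarrow> 'o" where
  "shift E A = Tgt E (Prj E A)"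

definition injective_hulls :: "('o, 'm, 'z) hulled_data_scheme \<Rightarrow> bool" where
  "injective_hulls E \<longleftrightarrow>
     (\<forall>A \<in> Obj E. (Inc E A, Prj E A) \<in> Confl E \<and> Src E (Inc E A) = A \<and> injective E (hull E A))"

section \<open>The stable category and its triangles\<close>

definition null_homs :: "('o, 'm, 'z) exact_data_scheme \<Rightarrow> 'o \<Rightarrow> 'o \<Rightarrow> 'm set" where
  "null_homs E A B = {h \<cdot>\<^bsub>E\<^esub> g | g h P. projective E P \<and> g \<in> homs E A P \<and> h \<in> homs E P B}"

text \<open>The image of \<open>f\<close> in the quotient category: its coset modulo the morphisms that factor
  through a projective.\<close>

definition stable_class :: "('o, 'm, 'z) exact_data_scheme \<Rightarrow> 'm \<Rightarrow> 'm set" where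
  "stable_class E f =
     null_homs E (Src E f) (Tgt E f) #>\<^bsub>hom_group E (Src E f) (Tgt E f)\<^esub> f"

definition rep :: "'m set \<Rightarrow> 'm" where
  "rep F = (SOME f. f \<in> F)"

text \<open>The quotient category \<open>E/P\<close>. All operations are computed on arbitrary representatives; in a
  Frobenius category they do not depend on these.\<close>

definition stable :: "('o, 'm, 'z) exact_data_scheme \<Rightarrow> ('o, 'm set) category_data" where
  "stable E = \<lparr>
     Obj = Obj E,
     Arr = stable_class E ` Arr E,
     Src = (\<lambda>F. Src E (rep F)),
     Tgt = (\<lambda>F. Tgt E (rep F)),
     Idn = (\<lambda>A. stable_class E (Idn E A)),
     Cmp = (\<lambda>G F. stable_class E (rep G \<cdot>\<^bsub>E\<^esub> rep F)),
     Add = (\<lambda>F G. stable_class E (Add E (rep F) (rep G))),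
     Zer = (\<lambda>A B. stable_class E (Zer E A B))\<rparr>"

text \<open>The shift of a morphism \<open>F\<close> of the stable category: the class of any \<open>h\<close> fitting into a
  morphism of conflations \<open>(f, g, h)\<close> from \<open>A \<rightarrow> I(A) \<rightarrow> A[1]\<close> to \<open>B \<rightarrow> I(B) \<rightarrow> B[1]\<close> with \<open>f\<close> in \<open>F\<close>.\<close>

definition shift_arr :: "('o, 'm, 'z) hulled_data_scheme \<Rightarrow> 'm set \<Rightarrow> 'm set" where
  "shift_arr E F = (THE H. \<exists>A B f g h.
     f \<in> F \<and> f \<in> homs E A B \<and> g \<in> homs E (hull E A) (hull E B) \<and>
     h \<in> homs E (shift E A) (shift E B) \<and>
     g \<cdot>\<^bsub>E\<^esub> Inc E A = Inc E B \<cdot>\<^bsub>E\<^esub> f \<and> h \<cdot>\<^bsub>E\<^esub> Prj E A = Prj E B \<cdot>\<^bsub>E\<^esub> g \<and>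
     H = stable_class E h)"

text \<open>A candidate triangle is a triple \<open>(u, v, w)\<close> of composable morphisms
  \<open>A \<rightarrow> B \<rightarrow> D \<rightarrow> A[1]\<close> of the stable category.\<close>

type_synonym 'm triangle = "'m set \<times> 'm set \<times> 'm set"

definition candidate_triangle :: "('o, 'm, 'z) hulled_data_scheme \<Rightarrow> 'm triangle \<Rightarrow> bool" where
  "candidate_triangle E = (\<lambda>(u, v, w).
     u \<in> Arr (stable E) \<and> v \<in> Arr (stable E) \<and> w \<in> Arr (stable E) \<and>
     Src (stable E) v = Tgt (stable E) u \<and> Src (stable E) w = Tgt (stable E) v \<and>
     Tgt (stable E) w = shift E (Src (stable E) u))"

definition triangle_morphism ::
  "('o, 'm, 'z) hulled_data_scheme \<Rightarrow> 'm triangle \<Rightarrow> 'm triangle \<Rightarrow>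
     'm set \<Rightarrow> 'm set \<Rightarrow> 'm set \<Rightarrow> bool" where
  "triangle_morphism E = (\<lambda>(u, v, w) (u', v', w') a b c.
     candidate_triangle E (u, v, w) \<and> candidate_triangle E (u', v', w') \<and>
     a \<in> homs (stable E) (Src (stable E) u) (Src (stable E) u') \<and>
     b \<in> homs (stable E) (Src (stable E) v) (Src (stable E) v') \<and>
     c \<in> homs (stable E) (Src (stable E) w) (Src (stable E) w') \<and>
     b \<cdot>\<^bsub>stable E\<^esub> u = u' \<cdot>\<^bsub>stable E\<^esub> a \<and>
     c \<cdot>\<^bsub>stable E\<^esub> v = v' \<cdot>\<^bsub>stable E\<^esub> b \<and>
     shift_arr E a \<cdot>\<^bsub>stable E\<^esub> w = w' \<cdot>\<^bsub>stable E\<^esub> c)"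

text \<open>Happel's triangulation: the standard triangle on \<open>u : A \<rightarrow> B\<close> is obtained from the pushout
  \<open>B \<rightarrow> D \<leftarrow> I(A)\<close> of \<open>u\<close> and \<open>A \<rightarrow> I(A)\<close>, with \<open>D \<rightarrow> A[1]\<close> induced by \<open>I(A) \<rightarrow> A[1]\<close> and
  \<open>0 : B \<rightarrow> A[1]\<close>; the distinguished triangles are those isomorphic to a standard one.\<close>

definition standard_triangle :: "('o, 'm, 'z) hulled_data_scheme \<Rightarrow> 'm triangle \<Rightarrow> bool" where
  "standard_triangle E t \<longleftrightarrow> (\<exists>A B D u v x w.
     u \<in> homs E A B \<and> v \<in> homs E B D \<and> x \<in> homs E (hull E A) D \<and> w \<in> homs E D (shift E A) \<and>
     is_pushout E u (Inc E A) v x \<and>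
     w \<cdot>\<^bsub>E\<^esub> x = Prj E A \<and> w \<cdot>\<^bsub>E\<^esub> v = Zer E B (shift E A) \<and>
     t = (stable_class E u, stable_class E v, stable_class E w))"

definition distinguished :: "('o, 'm, 'z) hulled_data_scheme \<Rightarrow> 'm triangle \<Rightarrow> bool" where
  "distinguished E t \<longleftrightarrow> (\<exists>s a b c. standard_triangle E s \<and> triangle_morphism E s t a b c \<and>
     isomorphism (stable E) a \<and> isomorphism (stable E) b \<and> isomorphism (stable E) c)"

section \<open>Precovers, resolutions and homotopy approximation\<close>

definition precover ::
  "('o, 'm, 'z) category_data_scheme \<Rightarrow> 'o set \<Rightarrow> 'o \<Rightarrow> 'm \<Rightarrow> bool" where
  "precover E \<R> X p \<longleftrightarrow> p \<in> Arr E \<and> Src E p \<in> \<R> \<and> Tgt E p = X \<and>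
     (\<forall>R \<in> \<R>. \<forall>f \<in> homs E R X. \<exists>g \<in> homs E R (Src E p). p \<cdot>\<^bsub>E\<^esub> g = f)"

definition precovering :: "('o, 'm, 'z) category_data_scheme \<Rightarrow> 'o set \<Rightarrow> bool" where
  "precovering E \<R> \<longleftrightarrow> (\<forall>X \<in> Obj E. \<exists>p. precover E \<R> X p)"

text \<open>\<open>R[1]\<close> is the chosen object \<open>shift E R\<close>. The object \<open>R[-1]\<close> is only determined up to
  isomorphism in the stable category, by \<open>R[-1][1] \<cong> R\<close>; one such object is required to be in
  the class.\<close>

definition closed_under_shifts :: "('o, 'm, 'z) hulled_data_scheme \<Rightarrow> 'o set \<Rightarrow> bool" where
  "closed_under_shifts E \<R> \<longleftrightarrow>
     (\<forall>R \<in> \<R>. shift E R \<in> \<R> \<and> (\<exists>R' \<in> \<R>. isomorphic (stable E) (shift E R') R))"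

text \<open>A truncated resolution of length \<open>d\<close>: precovers \<open>p i : Rs i \<rightarrow> K i\<close> with kernels
  \<open>k i : K (i + 1) \<rightarrow> Rs i\<close> for \<open>i < d\<close>, and \<open>Rs d = K d\<close> in the class.\<close>

definition resolution ::
  "('o, 'm, 'z) category_data_scheme \<Rightarrow> 'o set \<Rightarrow> 'o \<Rightarrow> nat \<Rightarrow>
     (nat \<Rightarrow> 'o) \<Rightarrow> (nat \<Rightarrow> 'o) \<Rightarrow> (nat \<Rightarrow> 'm) \<Rightarrow> (nat \<Rightarrow> 'm) \<Rightarrow> bool" where
  "resolution E \<R> X d K Rs p k \<longleftrightarrow> K 0 = X \<and>
     (\<forall>i < d. p i \<in> homs E (Rs i) (K i) \<and> precover E \<R> (K i) (p i) \<and>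
              k i \<in> homs E (K (Suc i)) (Rs i) \<and> is_kernel E (p i) (k i)) \<and>
     Rs d = K d \<and> K d \<in> \<R>"

definition has_dimension ::
  "('o, 'm, 'z) category_data_scheme \<Rightarrow> 'o set \<Rightarrow> 'o \<Rightarrow> nat \<Rightarrow> bool" where
  "has_dimension E \<R> X d \<longleftrightarrow>
     (\<exists>K Rs p k. resolution E \<R> X d K Rs p k) \<and>
     (\<forall>d' < d. \<not> (\<exists>K Rs p k. resolution E \<R> X d' K Rs p k))"

text \<open>The objects \<open>L d, \<dots>, L 0\<close> and morphisms \<open>l i : L i \<rightarrow> K i\<close> of the stable category result from
  some run of the construction, all of whose choices are left open. Step \<open>i\<close> passes from
  \<open>l (i + 1)\<close> to \<open>l i\<close>: it completes the composite \<open>\<epsilon>\<close> to a distinguished triangle \<open>(\<epsilon>, a, b)\<close>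
  and maps the latter to the triangle \<open>0 \<rightarrow> K i = K i \<rightarrow> 0\<close>, whose last object is the shift of
  the zero object \<open>Z\<close>.\<close>

definition homotopy_approximation ::
  "('o, 'm, 'z) hulled_data_scheme \<Rightarrow> nat \<Rightarrow>
     (nat \<Rightarrow> 'o) \<Rightarrow> (nat \<Rightarrow> 'o) \<Rightarrow> (nat \<Rightarrow> 'm) \<Rightarrow> (nat \<Rightarrow> 'm) \<Rightarrow>
     (nat \<Rightarrow> 'o) \<Rightarrow> (nat \<Rightarrow> 'm set) \<Rightarrow> bool" where
  "homotopy_approximation E d K Rs p k L l \<longleftrightarrow>
     L d = Rs d \<and> l d = Idn (stable E) (K d) \<and>
     (\<forall>i < d. \<exists>\<epsilon> a b Z.
        \<epsilon> = stable_class E (k i) \<cdot>\<^bsub>stable E\<^esub> l (Suc i) \<and>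
        \<epsilon> \<in> homs (stable E) (L (Suc i)) (Rs i) \<and>
        a \<in> homs (stable E) (Rs i) (L i) \<and>
        b \<in> homs (stable E) (L i) (shift E (L (Suc i))) \<and>
        distinguished E (\<epsilon>, a, b) \<and>
        l i \<in> homs (stable E) (L i) (K i) \<and>
        zero_object E Z \<and>
        triangle_morphism E (\<epsilon>, a, b)
          (Zer (stable E) Z (K i), Idn (stable E) (K i), Zer (stable E) (K i) (shift E Z))
          (Zer (stable E) (L (Suc i)) Z) (stable_class E (p i)) (l i))"

end

theory Submission
  imports Defs
begin

text \<open>
  Write \<open>(R, A)\<close> for the morphisms in the stable category, \<open>R\<close> being in the class \<open>\<R>\<close>. The idea is
  that on the functors \<open>(R, -)\<close> each kernel sequence \<open>K (i + 1) \<rightarrow> Rs i \<rightarrow> K i\<close> of the resolution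
  behaves like the triangle \<open>L (i + 1) \<rightarrow> Rs i \<rightarrow> L i\<close>, although it need not be a conflation; so
  \<open>(R, L i) \<cong> (R, K i)\<close> follows by downward induction on \<open>i\<close>, starting from \<open>L d = K d\<close>.

  On the side of the resolution,
  \<open>0 \<rightarrow> (R, K (i + 1)) \<rightarrow> (R, Rs i) \<rightarrow> (R, K i) \<rightarrow> 0\<close>
  is exact. Surjectivity is the precover property. For the other two assertions, a morphism
  that is stably zero extends to the hull \<open>I(R)\<close>; as \<open>I(R)\<close> and \<open>R[1]\<close> again belong to \<open>\<R>\<close>, the
  morphisms from them to \<open>K i\<close> that arise can be lifted through the precover and
  subtracted (\<open>precover_stable_exact\<close>, \<open>precover_kernel_stable_injective\<close>).

  On the side of the triangle \<open>(\<epsilon>, a, b)\<close>, composition with \<open>\<epsilon> = k i \<circ> l (i + 1)\<close> is injective on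
  \<open>(R, -)\<close> for all \<open>R\<close> in \<open>\<R>\<close>, by the induction hypothesis and the exactness just described. Since
  each \<open>R\<close> is isomorphic to a shift \<open>R'[1]\<close> with \<open>R'\<close> in \<open>\<R>\<close>, the long exact sequence makes the
  connecting map \<open>(R, L i) \<rightarrow> (R, L (i + 1)[1])\<close> vanish, so every morphism \<open>R \<rightarrow> L i\<close> lifts along
  \<open>a\<close>. This is \<open>distinguished_triangle_lift\<close>; it is proved for standard triangles by a direct
  computation with the pushout and carried along the isomorphism of triangles, of which
  the two left squares suffice. Hence both \<open>(R, L i)\<close> and \<open>(R, K i)\<close> are the cokernel of
  \<open>(R, K (i + 1)) \<rightarrow> (R, Rs i)\<close>, and \<open>l i\<close> is the comparison map (\<open>iso_on_homs_from_step\<close>).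

  The computations take place on representatives in the exact category. A morphism out of \<open>A\<close>
  is stably zero if and only if it extends along \<open>A \<rightarrow> I(A)\<close>, which replaces the unspecified
  projective by one that depends only on \<open>A\<close>. Two parallel morphisms with the same
  composite with a map that has a kernel differ by a morphism through that kernel, and dually;
  this is the form in which subtraction is used.
\<close>

section \<open>Preadditive categories\<close>

context preadditive_category
begin

lemma homs_obj:
  assumes "f \<in> homs C A B"
  shows "A \<in> Obj C" and "B \<in> Obj C"
  using assms src_obj tgt_obj by (auto simp: homs_def)

lemma zer_hom: "\<lbrakk>A \<in> Obj C; B \<in> Obj C\<rbrakk> \<Longrightarrow> Zer C A B \<in> homs C A B"
  using monoid.one_closed[of "hom_group C A B"] hom_comm_group[of A B]
  by (simp add: hom_group_def comm_group_def group_def)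

lemma add_hom:
  assumes "f \<in> homs C A B" and "g \<in> homs C A B"
  shows "Add C f g \<in> homs C A B"
  using monoid.m_closed[of "hom_group C A B" f g] hom_comm_group[OF homs_obj[OF assms(1)]] assms
  by (simp add: hom_group_def comm_group_def group_def)

lemma add_assoc:
  assumes "f \<in> homs C A B" and "g \<in> homs C A B" and "h \<in> homs C A B"
  shows "Add C (Add C f g) h = Add C f (Add C g h)"
  using monoid.m_assoc[of "hom_group C A B" f g h] hom_comm_group[OF homs_obj[OF assms(1)]] assms
  by (simp add: hom_group_def comm_group_def group_def)

lemma add_commute:
  assumes "f \<in> homs C A B" and "g \<in> homs C A B"
  shows "Add C f g = Add C g f"
  using comm_monoid.m_comm[of "hom_group C A B" f g]
    hom_comm_group[OF homs_obj[OF assms(1)]] assms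
  by (simp add: hom_group_def comm_group_def)

lemma zer_add:
  assumes "f \<in> homs C A B"
  shows "Add C (Zer C A B) f = f"
  using monoid.l_one[of "hom_group C A B" f] hom_comm_group[OF homs_obj[OF assms]] assms
  by (simp add: hom_group_def comm_group_def group_def)

lemma add_zer:
  assumes "f \<in> homs C A B"
  shows "Add C f (Zer C A B) = f"
  using zer_add[OF assms] add_commute[OF assms zer_hom[OF homs_obj[OF assms]]] by simp

lemma ex_negative:
  assumes "f \<in> homs C A B"
  shows "\<exists>g \<in> homs C A B. Add C g f = Zer C A B"
  using group.l_inv_ex[of "hom_group C A B" f] hom_comm_group[OF homs_obj[OF assms]] assms
  by (simp add: hom_group_def comm_group_def)

lemma ex_difference:
  assumes f: "f \<in> homs C A B" and g: "g \<in> homs C A B"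
  shows "\<exists>d \<in> homs C A B. f = Add C d g"
proof -
  obtain n where n: "n \<in> homs C A B" "Add C n g = Zer C A B"
    using ex_negative[OF g] by blast
  have "Add C (Add C f n) g = f"
    using add_assoc[OF f n(1) g] n(2) add_zer[OF f] by simp
  then show ?thesis using add_hom[OF f n(1)] by metis
qed

lemma add_idem_zero:
  assumes f: "f \<in> homs C A B" and "Add C f f = f"
  shows "f = Zer C A B"
proof -
  obtain n where n: "n \<in> homs C A B" "Add C n f = Zer C A B"
    using ex_negative[OF f] by blast
  show ?thesis using add_assoc[OF n(1) f f] n(2) assms(2) zer_add[OF f] by simp
qed

lemma add_eq_self_zero:
  assumes d: "d \<in> homs C A B" and f: "f \<in> homs C A B" and eq: "Add C d f = f"
  shows "d = Zer C A B"
proof -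
  obtain n where n: "n \<in> homs C A B" "Add C n f = Zer C A B"
    using ex_negative[OF f] by blast
  have "Add C f n = Zer C A B" using n add_commute[OF f n(1)] by simp
  then show ?thesis using add_assoc[OF d f n(1)] eq add_zer[OF d] by simp
qed

lemma zer_cmp:
  assumes f: "f \<in> homs C A B" and D: "D \<in> Obj C"
  shows "Zer C B D \<cdot> f = Zer C A D"
proof -
  have z: "Zer C B D \<in> homs C B D" using zer_hom homs_obj(2)[OF f] D by blast
  show ?thesis
    using cmp_add_left[OF f z z] zer_add[OF z] add_idem_zero[OF cmp_hom[OF f z]] by simp
qed

lemma cmp_zer:
  assumes h: "h \<in> homs C B D" and A: "A \<in> Obj C"
  shows "h \<cdot> Zer C A B = Zer C A D"
proof -
  have z: "Zer C A B \<in> homs C A B" using zer_hom homs_obj(1)[OF h] A by blast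
  show ?thesis
    using cmp_add_right[OF z z h] zer_add[OF z] add_idem_zero[OF cmp_hom[OF z h]] by simp
qed

lemma kernel_universal:
  assumes ker: "is_kernel C f k" and k: "k \<in> homs C A B" and f: "f \<in> homs C B D"
    and g: "g \<in> homs C Y B" and zero: "f \<cdot> g = Zer C Y D"
  shows "\<exists>!h. h \<in> homs C Y A \<and> k \<cdot> h = g"
proof -
  have ends: "Src C k = A" "Src C f = B" "Tgt C f = D" using k f by (simp_all add: homs_def)
  show ?thesis using ker homs_obj(1)[OF g] g zero unfolding is_kernel_def ends by blast
qed

lemma kernel_factor:
  assumes "is_kernel C f k" and "k \<in> homs C A B" and "f \<in> homs C B D"
    and "g \<in> homs C Y B" and "f \<cdot> g = Zer C Y D"
  shows "\<exists>h \<in> homs C Y A. k \<cdot> h = g"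
  using kernel_universal[OF assms] by blast

lemma kernel_cmp:
  assumes "is_kernel C f k" and k: "k \<in> homs C A B" and f: "f \<in> homs C B D"
  shows "f \<cdot> k = Zer C A D"
  using assms unfolding is_kernel_def homs_def by auto

lemma kernel_mono:
  assumes ker: "is_kernel C f k" and k: "k \<in> homs C A B" and f: "f \<in> homs C B D"
    and h: "h \<in> homs C Y A" and h': "h' \<in> homs C Y A" and eq: "k \<cdot> h = k \<cdot> h'"
  shows "h = h'"
proof -
  have "f \<cdot> (k \<cdot> h) = Zer C Y D"
    using cmp_assoc[OF h k f] kernel_cmp[OF ker k f] zer_cmp[OF h homs_obj(2)[OF f]] by simp
  then show ?thesis using kernel_universal[OF ker k f cmp_hom[OF h k]] h h' eq by metis
qed

lemma kernel_difference:
  assumes ker: "is_kernel C f k" and k: "k \<in> homs C A B" and f: "f \<in> homs C B D"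
    and g: "g \<in> homs C Y B" and g': "g' \<in> homs C Y B" and eq: "f \<cdot> g = f \<cdot> g'"
  shows "\<exists>h \<in> homs C Y A. g = Add C (k \<cdot> h) g'"
proof -
  obtain e where e: "e \<in> homs C Y B" "g = Add C e g'"
    using ex_difference[OF g g'] by blast
  have "Add C (f \<cdot> e) (f \<cdot> g') = f \<cdot> g'"
    using cmp_add_right[OF e(1) g' f] e(2) eq by simp
  then have "f \<cdot> e = Zer C Y D"
    using add_eq_self_zero[OF cmp_hom[OF e(1) f] cmp_hom[OF g' f]] by simp
  then show ?thesis using kernel_factor[OF ker k f e(1)] e(2) by blast
qed

lemma cokernel_cmp:
  assumes "is_cokernel C f c" and f: "f \<in> homs C A B" and c: "c \<in> homs C B D"
  shows "c \<cdot> f = Zer C A D"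
  using assms unfolding is_cokernel_def homs_def by auto

lemma cokernel_universal:
  assumes cok: "is_cokernel C f c" and f: "f \<in> homs C A B" and c: "c \<in> homs C B D"
    and g: "g \<in> homs C B Y" and zero: "g \<cdot> f = Zer C A Y"
  shows "\<exists>!h. h \<in> homs C D Y \<and> h \<cdot> c = g"
proof -
  have ends: "Src C f = A" "Tgt C f = B" "Tgt C c = D" using f c by (simp_all add: homs_def)
  show ?thesis using cok homs_obj(2)[OF g] g zero unfolding is_cokernel_def ends by blast
qed

lemma cokernel_factor:
  assumes "is_cokernel C f c" and "f \<in> homs C A B" and "c \<in> homs C B D"
    and "g \<in> homs C B Y" and "g \<cdot> f = Zer C A Y"
  shows "\<exists>h \<in> homs C D Y. h \<cdot> c = g"
  using cokernel_universal[OF assms] by blast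

lemma cokernel_epi:
  assumes cok: "is_cokernel C f c" and f: "f \<in> homs C A B" and c: "c \<in> homs C B D"
    and h: "h \<in> homs C D Y" and h': "h' \<in> homs C D Y" and eq: "h \<cdot> c = h' \<cdot> c"
  shows "h = h'"
proof -
  have "(h \<cdot> c) \<cdot> f = Zer C A Y"
    using cmp_assoc[OF f c h] cokernel_cmp[OF cok f c] cmp_zer[OF h homs_obj(1)[OF f]] by simp
  then show ?thesis using cokernel_universal[OF cok f c cmp_hom[OF c h]] h h' eq by metis
qed

lemma cokernel_difference:
  assumes cok: "is_cokernel C f c" and f: "f \<in> homs C A B" and c: "c \<in> homs C B D"
    and g: "g \<in> homs C B Y" and g': "g' \<in> homs C B Y" and eq: "g \<cdot> f = g' \<cdot> f"
  shows "\<exists>h \<in> homs C D Y. g = Add C (h \<cdot> c) g'"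
proof -
  obtain e where e: "e \<in> homs C B Y" "g = Add C e g'"
    using ex_difference[OF g g'] by blast
  have "Add C (e \<cdot> f) (g' \<cdot> f) = g' \<cdot> f"
    using cmp_add_left[OF f e(1) g'] e(2) eq by simp
  then have "e \<cdot> f = Zer C A Y"
    using add_eq_self_zero[OF cmp_hom[OF f e(1)] cmp_hom[OF f g']] by simp
  then show ?thesis using cokernel_factor[OF cok f c e(1)] e(2) by blast
qed

lemma pushout_universal:
  assumes po: "is_pushout C f g i j"
    and f: "f \<in> homs C A B" and g: "g \<in> homs C A B'" and i: "i \<in> homs C B D"
    and a: "a \<in> homs C B Y" and b: "b \<in> homs C B' Y" and eq: "a \<cdot> f = b \<cdot> g"
  shows "\<exists>!h. h \<in> homs C D Y \<and> h \<cdot> i = a \<and> h \<cdot> j = b"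
proof -
  have ends: "Tgt C f = B" "Tgt C g = B'" "Tgt C i = D" using f g i by (simp_all add: homs_def)
  show ?thesis using po homs_obj(2)[OF a] a b eq unfolding is_pushout_def ends by blast
qed

lemma isomorphism_inverse:
  assumes "isomorphism C f" and "f \<in> homs C A B"
  obtains g where "g \<in> homs C B A" and "g \<cdot> f = Idn C A" and "f \<cdot> g = Idn C B"
  using assms unfolding isomorphism_def homs_def by auto

text \<open>An additive map is bijective once it is onto with trivial kernel. In this form the
  conclusion of the theorem can be established by diagram chases.\<close>

lemma cmp_iso_hom_group:
  assumes l: "l \<in> homs C L Y" and R: "R \<in> Obj C"
    and surj: "\<And>g. g \<in> homs C R Y \<Longrightarrow> \<exists>f \<in> homs C R L. l \<cdot> f = g"
    and ker: "\<And>f. \<lbrakk>f \<in> homs C R L; l \<cdot> f = Zer C R Y\<rbrakk> \<Longrightarrow> f = Zer C R L"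
  shows "(\<lambda>f. l \<cdot> f) \<in> iso (hom_group C R L) (hom_group C R Y)"
proof -
  have "inj_on (\<lambda>f. l \<cdot> f) (homs C R L)"
  proof (rule inj_onI)
    fix f g assume f: "f \<in> homs C R L" and g: "g \<in> homs C R L" and eq: "l \<cdot> f = l \<cdot> g"
    obtain e where e: "e \<in> homs C R L" "f = Add C e g"
      using ex_difference[OF f g] by blast
    have "Add C (l \<cdot> e) (l \<cdot> g) = l \<cdot> g"
      using cmp_add_right[OF e(1) g l] e(2) eq by simp
    then have "l \<cdot> e = Zer C R Y"
      using add_eq_self_zero[OF cmp_hom[OF e(1) l] cmp_hom[OF g l]] by simp
    then show "f = g" using ker[OF e(1)] e(2) zer_add[OF g] by simp
  qed
  moreover have "(\<lambda>f. l \<cdot> f) ` homs C R L = homs C R Y"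
    using surj cmp_hom[OF _ l] by (auto simp: image_iff)
  ultimately show ?thesis
    using cmp_hom[OF _ l] cmp_add_right[OF _ _ l]
    by (auto simp: iso_def hom_def hom_group_def bij_betw_def)
qed

end

section \<open>The stable category of a Frobenius category\<close>

locale hulled_frobenius_category = frobenius_category E
  for E :: "('o, 'm, 'z) hulled_data_scheme" (structure) +
  assumes injective_hulls: "injective_hulls E"
begin

abbreviation cls :: "'m \<Rightarrow> 'm set" where "cls \<equiv> stable_class E"

abbreviation T :: "('o, 'm set) category_data" where "T \<equiv> stable E"

lemma inc_hom: "A \<in> Obj E \<Longrightarrow> Inc E A \<in> homs E A (hull E A)"
  using injective_hulls confl_kernel[of "Inc E A" "Prj E A"]
  by (auto simp: injective_hulls_def is_kernel_def homs_def hull_def)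

lemma prj_hom: "A \<in> Obj E \<Longrightarrow> Prj E A \<in> homs E (hull E A) (shift E A)"
  using injective_hulls confl_kernel[of "Inc E A" "Prj E A"]
  by (auto simp: injective_hulls_def is_kernel_def homs_def hull_def shift_def)

lemma inc_kernel: "A \<in> Obj E \<Longrightarrow> is_kernel E (Prj E A) (Inc E A)"
  using injective_hulls confl_kernel by (auto simp: injective_hulls_def)

lemma prj_cokernel: "A \<in> Obj E \<Longrightarrow> is_cokernel E (Inc E A) (Prj E A)"
  using injective_hulls confl_cokernel by (auto simp: injective_hulls_def)

lemma hull_projective: "A \<in> Obj E \<Longrightarrow> projective E (hull E A)"
  using injective_hulls projective_iff_injective by (auto simp: injective_hulls_def)

lemma shift_obj: "A \<in> Obj E \<Longrightarrow> shift E A \<in> Obj E"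
  using homs_obj(2)[OF prj_hom] .

lemma hull_obj: "A \<in> Obj E \<Longrightarrow> hull E A \<in> Obj E"
  using homs_obj(2)[OF inc_hom] .

lemma hull_lift_shift:
  assumes A: "A \<in> Obj E" and B: "B \<in> Obj E" and h: "h \<in> homs E (hull E B) (shift E A)"
  shows "\<exists>y \<in> homs E (hull E B) (hull E A). Prj E A \<cdot> y = h"
proof -
  have "deflation E (Prj E A)"
    using injective_hulls A by (auto simp: injective_hulls_def deflation_def)
  moreover have "Src E (Prj E A) = hull E A" "Tgt E (Prj E A) = shift E A"
    using prj_hom[OF A] by (simp_all add: homs_def)
  ultimately show ?thesis
    using hull_projective[OF B] h unfolding projective_def by metis
qed

lemma extend_to_hull:
  assumes P: "projective E P" and g: "g \<in> homs E A P"
  shows "\<exists>t \<in> homs E (hull E A) P. t \<cdot> Inc E A = g"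
proof -
  have A: "A \<in> Obj E" using homs_obj(1)[OF g] .
  have "inflation E (Inc E A)"
    using injective_hulls A by (auto simp: injective_hulls_def inflation_def)
  moreover have "Src E (Inc E A) = A" "Tgt E (Inc E A) = hull E A"
    using inc_hom[OF A] by (simp_all add: homs_def)
  ultimately show ?thesis
    using P g unfolding projective_iff_injective injective_def by metis
qed

text \<open>A projective object is injective, so a morphism from \<open>A\<close> to it extends to the hull. Thus the
  single projective \<open>I(A)\<close> serves for all null morphisms out of \<open>A\<close>; in particular they are
  closed under addition without forming biproducts.\<close>

lemma null_homs_iff_extends:
  assumes A: "A \<in> Obj E"
  shows "f \<in> null_homs E A B \<longleftrightarrow> (\<exists>t \<in> homs E (hull E A) B. f = t \<cdot> Inc E A)"
proof
  assume "f \<in> null_homs E A B"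
  then obtain g h P where P: "projective E P" and g: "g \<in> homs E A P" and h: "h \<in> homs E P B"
    and f: "f = h \<cdot> g" unfolding null_homs_def by blast
  obtain t where t: "t \<in> homs E (hull E A) P" "t \<cdot> Inc E A = g"
    using extend_to_hull[OF P g] by blast
  then show "\<exists>t \<in> homs E (hull E A) B. f = t \<cdot> Inc E A"
    using cmp_assoc[OF inc_hom[OF A] t(1) h] cmp_hom[OF t(1) h] f by metis
next
  assume "\<exists>t \<in> homs E (hull E A) B. f = t \<cdot> Inc E A"
  then show "f \<in> null_homs E A B"
    using hull_projective[OF A] inc_hom[OF A] unfolding null_homs_def by blast
qed

lemma null_homs_subgroup:
  assumes A: "A \<in> Obj E" and B: "B \<in> Obj E"
  shows "subgroup (null_homs E A B) (hom_group E A B)"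
proof -
  interpret G: comm_group "hom_group E A B" using hom_comm_group[OF A B] .
  note i = inc_hom[OF A]
  show ?thesis
  proof (rule G.subgroupI)
    show "null_homs E A B \<subseteq> carrier (hom_group E A B)"
      using cmp_hom[OF i] by (auto simp: hom_group_def null_homs_iff_extends[OF A])
    show "null_homs E A B \<noteq> {}"
      using zer_hom[OF hull_obj[OF A] B] null_homs_iff_extends[OF A] by blast
  next
    fix a assume "a \<in> null_homs E A B"
    then obtain t where t: "t \<in> homs E (hull E A) B" "a = t \<cdot> Inc E A"
      using null_homs_iff_extends[OF A] by blast
    obtain n where n: "n \<in> homs E (hull E A) B" "Add E n t = Zer E (hull E A) B"
      using ex_negative[OF t(1)] by blast
    have "Add E (n \<cdot> Inc E A) a = Zer E A B"
      using cmp_add_left[OF i n(1) t(1)] n(2) t(2) zer_cmp[OF i B] by simp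
    then have "inv\<^bsub>hom_group E A B\<^esub> a = n \<cdot> Inc E A"
      using G.inv_equality[of "n \<cdot> Inc E A" a] cmp_hom[OF i n(1)] cmp_hom[OF i t(1)] t(2)
      by (simp add: hom_group_def)
    then show "inv\<^bsub>hom_group E A B\<^esub> a \<in> null_homs E A B"
      using n(1) null_homs_iff_extends[OF A] by auto
  next
    fix a b assume "a \<in> null_homs E A B" "b \<in> null_homs E A B"
    then obtain t s where t: "t \<in> homs E (hull E A) B" "a = t \<cdot> Inc E A"
      and s: "s \<in> homs E (hull E A) B" "b = s \<cdot> Inc E A"
      using null_homs_iff_extends[OF A] by blast
    then have "Add E a b = Add E t s \<cdot> Inc E A"
      using cmp_add_left[OF i t(1) s(1)] by simp
    then show "a \<otimes>\<^bsub>hom_group E A B\<^esub> b \<in> null_homs E A B"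
      using add_hom[OF t(1) s(1)] null_homs_iff_extends[OF A] by (auto simp: hom_group_def)
  qed
qed

lemma mem_cls_iff:
  assumes g: "g \<in> homs E A B"
  shows "f \<in> cls g \<longleftrightarrow> (\<exists>t \<in> homs E (hull E A) B. f = Add E (t \<cdot> Inc E A) g)"
proof -
  have "cls g = null_homs E A B #>\<^bsub>hom_group E A B\<^esub> g"
    using g unfolding stable_class_def homs_def by simp
  then show ?thesis
    using null_homs_iff_extends[OF homs_obj(1)[OF g], of _ B]
    unfolding r_coset_def hom_group_def by fastforce
qed

lemma cls_eq_iff:
  assumes f: "f \<in> homs E A B" and g: "g \<in> homs E A B"
  shows "cls f = cls g \<longleftrightarrow> (\<exists>t \<in> homs E (hull E A) B. f = Add E (t \<cdot> Inc E A) g)"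
proof -
  note ob = homs_obj[OF f]
  have cls: "cls h = null_homs E A B #>\<^bsub>hom_group E A B\<^esub> h" if "h \<in> homs E A B" for h
    using that unfolding stable_class_def homs_def by simp
  interpret G: comm_group "hom_group E A B" using hom_comm_group[OF ob] .
  have "f \<in> cls f"
    using G.rcos_self[OF _ null_homs_subgroup[OF ob]] f cls by (simp add: hom_group_def)
  moreover have "cls g = cls f" if "f \<in> cls g"
    using G.repr_independence[OF _ _ null_homs_subgroup[OF ob], of f g] that f g cls
    by (simp add: hom_group_def)
  ultimately show ?thesis using mem_cls_iff[OF g] by auto
qed

lemma rep_cls:
  assumes f: "f \<in> homs E A B"
  shows "rep (cls f) \<in> homs E A B" and "cls (rep (cls f)) = cls f"
proof -
  note ob = homs_obj[OF f]
  have "f \<in> cls f" using cls_eq_iff[OF f f] mem_cls_iff[OF f] by simp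
  then have "rep (cls f) \<in> cls f" unfolding rep_def by (rule someI)
  then obtain t where t: "t \<in> homs E (hull E A) B" "rep (cls f) = Add E (t \<cdot> Inc E A) f"
    using mem_cls_iff[OF f] by blast
  show 1: "rep (cls f) \<in> homs E A B"
    using t add_hom[OF cmp_hom[OF inc_hom[OF ob(1)] t(1)] f] by simp
  show "cls (rep (cls f)) = cls f" using cls_eq_iff[OF 1 f] t by blast
qed

lemma stable_homs: "homs T A B = cls ` homs E A B"
proof
  show "homs T A B \<subseteq> cls ` homs E A B"
  proof
    fix F assume F: "F \<in> homs T A B"
    then obtain f where f: "f \<in> Arr E" "F = cls f" by (auto simp: homs_def stable_def)
    have f': "f \<in> homs E (Src E f) (Tgt E f)" using f(1) by (simp add: homs_def)
    have "Src E f = A" "Tgt E f = B"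
      using rep_cls(1)[OF f'] F f(2) by (auto simp: homs_def stable_def)
    then show "F \<in> cls ` homs E A B" using f' f(2) by auto
  qed
  show "cls ` homs E A B \<subseteq> homs T A B"
  proof
    fix F assume "F \<in> cls ` homs E A B"
    then obtain f where f: "f \<in> homs E A B" "F = cls f" by blast
    then show "F \<in> homs T A B"
      using rep_cls(1)[OF f(1)] by (auto simp: homs_def stable_def)
  qed
qed

lemma cls_hom: "f \<in> homs E A B \<Longrightarrow> cls f \<in> homs T A B"
  using stable_homs by blast

lemma stable_homE:
  assumes "F \<in> homs T A B"
  obtains f where "f \<in> homs E A B" and "F = cls f"
  using assms stable_homs by blast

lemma cls_add_cong:
  assumes f: "f \<in> homs E A B" and f': "f' \<in> homs E A B" and g: "g \<in> homs E A B"
    and eq: "cls f = cls f'"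
  shows "cls (Add E f g) = cls (Add E f' g)"
proof -
  note i = inc_hom[OF homs_obj(1)[OF f]]
  obtain t where t: "t \<in> homs E (hull E A) B" "f = Add E (t \<cdot> Inc E A) f'"
    using cls_eq_iff[OF f f'] eq by blast
  have "Add E f g = Add E (t \<cdot> Inc E A) (Add E f' g)"
    using add_assoc[OF cmp_hom[OF i t(1)] f' g] t(2) by simp
  then show ?thesis using cls_eq_iff[OF add_hom[OF f g] add_hom[OF f' g]] t(1) by blast
qed

lemma stable_add:
  assumes f: "f \<in> homs E A B" and g: "g \<in> homs E A B"
  shows "Add T (cls f) (cls g) = cls (Add E f g)"
proof -
  note rf = rep_cls[OF f] and rg = rep_cls[OF g]
  have "cls (Add E (rep (cls f)) (rep (cls g))) = cls (Add E f (rep (cls g)))"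
    using cls_add_cong[OF rf(1) f rg(1) rf(2)] .
  also have "\<dots> = cls (Add E f g)"
    using cls_add_cong[OF rg(1) g f rg(2)] add_commute[OF f rg(1)] add_commute[OF f g] by simp
  finally show ?thesis by (simp add: stable_def)
qed

lemma cls_cmp_cong_left:
  assumes f: "f \<in> homs E A B" and g: "g \<in> homs E B D" and g': "g' \<in> homs E B D"
    and eq: "cls g = cls g'"
  shows "cls (g \<cdot> f) = cls (g' \<cdot> f)"
proof -
  note A = homs_obj(1)[OF f] and B = homs_obj(2)[OF f]
  note i = inc_hom[OF A] and j = inc_hom[OF B]
  obtain t where t: "t \<in> homs E (hull E B) D" "g = Add E (t \<cdot> Inc E B) g'"
    using cls_eq_iff[OF g g'] eq by blast
  obtain s where s: "s \<in> homs E (hull E A) (hull E B)" "s \<cdot> Inc E A = Inc E B \<cdot> f"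
    using extend_to_hull[OF hull_projective[OF B] cmp_hom[OF f j]] by blast
  have "(t \<cdot> Inc E B) \<cdot> f = (t \<cdot> s) \<cdot> Inc E A"
    using cmp_assoc[OF f j t(1)] cmp_assoc[OF i s(1) t(1)] s(2) by simp
  then have "g \<cdot> f = Add E ((t \<cdot> s) \<cdot> Inc E A) (g' \<cdot> f)"
    using cmp_add_left[OF f cmp_hom[OF j t(1)] g'] t(2) by simp
  then show ?thesis
    using cls_eq_iff[OF cmp_hom[OF f g] cmp_hom[OF f g']] cmp_hom[OF s(1) t(1)] by blast
qed

lemma cls_cmp_cong_right:
  assumes f: "f \<in> homs E A B" and f': "f' \<in> homs E A B" and g: "g \<in> homs E B D"
    and eq: "cls f = cls f'"
  shows "cls (g \<cdot> f) = cls (g \<cdot> f')"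
proof -
  note i = inc_hom[OF homs_obj(1)[OF f]]
  obtain t where t: "t \<in> homs E (hull E A) B" "f = Add E (t \<cdot> Inc E A) f'"
    using cls_eq_iff[OF f f'] eq by blast
  have "g \<cdot> f = Add E ((g \<cdot> t) \<cdot> Inc E A) (g \<cdot> f')"
    using cmp_add_right[OF cmp_hom[OF i t(1)] f' g] t(2) cmp_assoc[OF i t(1) g] by simp
  then show ?thesis
    using cls_eq_iff[OF cmp_hom[OF f g] cmp_hom[OF f' g]] cmp_hom[OF t(1) g] by blast
qed

lemma stable_cmp:
  assumes f: "f \<in> homs E A B" and g: "g \<in> homs E B D"
  shows "cls g \<cdot>\<^bsub>T\<^esub> cls f = cls (g \<cdot> f)"
proof -
  note rf = rep_cls[OF f] and rg = rep_cls[OF g]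
  have "cls (rep (cls g) \<cdot> rep (cls f)) = cls (g \<cdot> rep (cls f))"
    using cls_cmp_cong_left[OF rf(1) rg(1) g rg(2)] .
  also have "\<dots> = cls (g \<cdot> f)" using cls_cmp_cong_right[OF rf(1) f g rf(2)] .
  finally show ?thesis by (simp add: stable_def)
qed

lemma stable_obj [simp]: "Obj T = Obj E" by (simp add: stable_def)

lemma stable_idn: "Idn T A = cls (Idn E A)" by (simp add: stable_def)

lemma stable_zer: "Zer T A B = cls (Zer E A B)" by (simp add: stable_def)

lemma stable_hom_comm_group:
  assumes A: "A \<in> Obj E" and B: "B \<in> Obj E"
  shows "comm_group (hom_group T A B)"
proof (rule comm_groupI)
  fix F G assume "F \<in> carrier (hom_group T A B)" "G \<in> carrier (hom_group T A B)"
  then obtain f g where f: "f \<in> homs E A B" "F = cls f" and g: "g \<in> homs E A B" "G = cls g"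
    by (auto simp: hom_group_def stable_homs)
  show "F \<otimes>\<^bsub>hom_group T A B\<^esub> G \<in> carrier (hom_group T A B)"
    using stable_add[OF f(1) g(1)] f g cls_hom[OF add_hom[OF f(1) g(1)]]
    by (simp add: hom_group_def)
  show "F \<otimes>\<^bsub>hom_group T A B\<^esub> G = G \<otimes>\<^bsub>hom_group T A B\<^esub> F"
    using stable_add[OF f(1) g(1)] stable_add[OF g(1) f(1)] f g add_commute[OF f(1) g(1)]
    by (simp add: hom_group_def)
next
  show "\<one>\<^bsub>hom_group T A B\<^esub> \<in> carrier (hom_group T A B)"
    using cls_hom[OF zer_hom[OF A B]] by (simp add: hom_group_def stable_zer)
next
  fix F G H assume "F \<in> carrier (hom_group T A B)" "G \<in> carrier (hom_group T A B)"
    "H \<in> carrier (hom_group T A B)"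
  then obtain f g h where f: "f \<in> homs E A B" "F = cls f" and g: "g \<in> homs E A B" "G = cls g"
    and h: "h \<in> homs E A B" "H = cls h"
    by (auto simp: hom_group_def stable_homs)
  show "F \<otimes>\<^bsub>hom_group T A B\<^esub> G \<otimes>\<^bsub>hom_group T A B\<^esub> H
      = F \<otimes>\<^bsub>hom_group T A B\<^esub> (G \<otimes>\<^bsub>hom_group T A B\<^esub> H)"
    using stable_add[OF f(1) g(1)] stable_add[OF g(1) h(1)]
      stable_add[OF add_hom[OF f(1) g(1)] h(1)] stable_add[OF f(1) add_hom[OF g(1) h(1)]]
      f g h add_assoc[OF f(1) g(1) h(1)]
    by (simp add: hom_group_def)
next
  fix F assume "F \<in> carrier (hom_group T A B)"
  then obtain f where f: "f \<in> homs E A B" "F = cls f"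
    by (auto simp: hom_group_def stable_homs)
  show "\<one>\<^bsub>hom_group T A B\<^esub> \<otimes>\<^bsub>hom_group T A B\<^esub> F = F"
    using stable_add[OF zer_hom[OF A B] f(1)] f zer_add[OF f(1)]
    by (simp add: hom_group_def stable_zer)
  obtain n where n: "n \<in> homs E A B" "Add E n f = Zer E A B"
    using ex_negative[OF f(1)] by blast
  then show "\<exists>G \<in> carrier (hom_group T A B). G \<otimes>\<^bsub>hom_group T A B\<^esub> F = \<one>\<^bsub>hom_group T A B\<^esub>"
    using stable_add[OF n(1) f(1)] f cls_hom[OF n(1)]
    by (auto simp: hom_group_def stable_zer)
qed

text \<open>Composition and addition of classes, computed on representatives, agree with those of the
  underlying morphisms, so all the axioms descend to the quotient.\<close>

lemma stable_preadditive: "preadditive_category T"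
proof (rule preadditive_category.intro)
  fix F assume "F \<in> Arr T"
  then have F: "F \<in> homs T (Src T F) (Tgt T F)" by (simp add: homs_def)
  then obtain f where "f \<in> homs E (Src T F) (Tgt T F)" by (rule stable_homE)
  then show "Src T F \<in> Obj T" "Tgt T F \<in> Obj T" using homs_obj by auto
next
  fix A assume "A \<in> Obj T"
  then show "Idn T A \<in> homs T A A" using cls_hom[OF idn_hom] by (simp add: stable_idn)
next
  fix F G A B D assume "F \<in> homs T A B" "G \<in> homs T B D"
  then obtain f g where f: "f \<in> homs E A B" "F = cls f" and g: "g \<in> homs E B D" "G = cls g"
    by (metis stable_homE)
  show "G \<cdot>\<^bsub>T\<^esub> F \<in> homs T A D"
    using stable_cmp[OF f(1) g(1)] f g cls_hom[OF cmp_hom[OF f(1) g(1)]] by simp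
next
  fix F A B assume "F \<in> homs T A B"
  then obtain f where f: "f \<in> homs E A B" "F = cls f" by (metis stable_homE)
  show "F \<cdot>\<^bsub>T\<^esub> Idn T A = F"
    using stable_cmp[OF idn_hom[OF homs_obj(1)[OF f(1)]] f(1)] f cmp_idn[OF f(1)]
    by (simp add: stable_idn)
  show "Idn T B \<cdot>\<^bsub>T\<^esub> F = F"
    using stable_cmp[OF f(1) idn_hom[OF homs_obj(2)[OF f(1)]]] f idn_cmp[OF f(1)]
    by (simp add: stable_idn)
next
  fix F G H A B D Y
  assume "F \<in> homs T A B" "G \<in> homs T B D" "H \<in> homs T D Y"
  then obtain f g h where f: "f \<in> homs E A B" "F = cls f" and g: "g \<in> homs E B D" "G = cls g"
    and h: "h \<in> homs E D Y" "H = cls h"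
    by (metis stable_homE)
  show "(H \<cdot>\<^bsub>T\<^esub> G) \<cdot>\<^bsub>T\<^esub> F = H \<cdot>\<^bsub>T\<^esub> (G \<cdot>\<^bsub>T\<^esub> F)"
    using stable_cmp[OF f(1) g(1)] stable_cmp[OF g(1) h(1)]
      stable_cmp[OF f(1) cmp_hom[OF g(1) h(1)]] stable_cmp[OF cmp_hom[OF f(1) g(1)] h(1)]
      cmp_assoc[OF f(1) g(1) h(1)] f g h by simp
next
  fix F G H A B D
  assume "F \<in> homs T A B" "G \<in> homs T B D" "H \<in> homs T B D"
  then obtain f g h where f: "f \<in> homs E A B" "F = cls f" and g: "g \<in> homs E B D" "G = cls g"
    and h: "h \<in> homs E B D" "H = cls h"
    by (metis stable_homE)
  show "Add T G H \<cdot>\<^bsub>T\<^esub> F = Add T (G \<cdot>\<^bsub>T\<^esub> F) (H \<cdot>\<^bsub>T\<^esub> F)"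
    using stable_cmp[OF f(1) g(1)] stable_cmp[OF f(1) h(1)]
      stable_add[OF g(1) h(1)] stable_cmp[OF f(1) add_hom[OF g(1) h(1)]]
      stable_add[OF cmp_hom[OF f(1) g(1)] cmp_hom[OF f(1) h(1)]]
      cmp_add_left[OF f(1) g(1) h(1)] f g h by simp
next
  fix F G H A B D
  assume "F \<in> homs T A B" "G \<in> homs T A B" "H \<in> homs T B D"
  then obtain f g h where f: "f \<in> homs E A B" "F = cls f" and g: "g \<in> homs E A B" "G = cls g"
    and h: "h \<in> homs E B D" "H = cls h"
    by (metis stable_homE)
  show "H \<cdot>\<^bsub>T\<^esub> Add T F G = Add T (H \<cdot>\<^bsub>T\<^esub> F) (H \<cdot>\<^bsub>T\<^esub> G)"
    using stable_cmp[OF f(1) h(1)] stable_cmp[OF g(1) h(1)]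
      stable_add[OF f(1) g(1)] stable_cmp[OF add_hom[OF f(1) g(1)] h(1)]
      stable_add[OF cmp_hom[OF f(1) h(1)] cmp_hom[OF g(1) h(1)]]
      cmp_add_right[OF f(1) g(1) h(1)] f g h by simp
next
  fix A B assume "A \<in> Obj T" "B \<in> Obj T"
  then show "comm_group (hom_group T A B)" using stable_hom_comm_group by simp
qed

sublocale st: preadditive_category T
  by (rule stable_preadditive)

lemma cls_zero_iff:
  assumes f: "f \<in> homs E A B"
  shows "cls f = Zer T A B \<longleftrightarrow> (\<exists>t \<in> homs E (hull E A) B. f = t \<cdot> Inc E A)"
proof -
  note ob = homs_obj[OF f]
  show ?thesis
    using cls_eq_iff[OF f zer_hom[OF ob]] add_zer[OF cmp_hom[OF inc_hom[OF ob(1)]]]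
    by (auto simp: stable_zer)
qed

lemma cls_zero_if_factors:
  assumes P: "projective E P" and g: "g \<in> homs E A P" and h: "h \<in> homs E P B"
  shows "cls (h \<cdot> g) = Zer T A B"
  using cls_zero_iff[OF cmp_hom[OF g h]] null_homs_iff_extends[OF homs_obj(1)[OF g]] P g h
  unfolding null_homs_def by blast

section \<open>Triangles\<close>

text \<open>In the pushout of an inflation, the cokernel of the parallel map \<open>v\<close> is the cokernel \<open>A[1]\<close>
  of the inflation. The map \<open>v\<close> is itself an inflation up to isomorphism, hence a kernel of its
  cokernel.\<close>

lemma standard_triangle_kernel:
  assumes u: "u \<in> homs E A B" and v: "v \<in> homs E B D" and x: "x \<in> homs E (hull E A) D"
    and w: "w \<in> homs E D (shift E A)" and po: "is_pushout E u (Inc E A) v x"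
    and wx: "w \<cdot> x = Prj E A" and wv: "w \<cdot> v = Zer E B (shift E A)"
  shows "is_kernel E w v"
proof -
  note ob = homs_obj[OF u]
  note i = inc_hom[OF ob(1)] and pr = prj_hom[OF ob(1)]
  have po_comm: "v \<cdot> u = x \<cdot> Inc E A" using po by (simp add: is_pushout_def)
  have po_univ: "\<exists>!h. h \<in> homs E D Y \<and> h \<cdot> v = a \<and> h \<cdot> x = b"
    if "a \<in> homs E B Y" "b \<in> homs E (hull E A) Y" "a \<cdot> u = b \<cdot> Inc E A" for a b Y
    using pushout_universal[OF po u i v that] .
  have "inflation E (Inc E A)"
    using injective_hulls ob by (auto simp: injective_hulls_def inflation_def)
  then obtain x' j where po': "is_pushout E (Inc E A) u x' j" and "inflation E j"
    using pushout_inflation[of "Inc E A" u] u i by (auto simp: homs_def)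
  then obtain c where conf: "(j, c) \<in> Confl E" by (auto simp: inflation_def)
  define D' where "D' = Tgt E j"
  have j: "j \<in> homs E B D'" and x': "x' \<in> homs E (hull E A) D'" and c: "c \<in> homs E D' (Tgt E c)"
    using po' u i confl_kernel[OF conf]
    by (auto simp: is_pushout_def homs_def D'_def is_kernel_def)
  have po'_comm: "x' \<cdot> Inc E A = j \<cdot> u" using po' by (simp add: is_pushout_def)
  \<comment> \<open>The inflation \<open>j\<close> belongs to some pushout; \<open>\<eta>\<close> and \<open>\<theta>\<close> compare it with the given one.\<close>
  obtain \<eta> where \<eta>: "\<eta> \<in> homs E D D'" "\<eta> \<cdot> v = j" "\<eta> \<cdot> x = x'"
    using po_univ[OF j x'] po'_comm by auto
  have "\<exists>!h. h \<in> homs E D' D \<and> h \<cdot> x' = x \<and> h \<cdot> j = v"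
    using pushout_universal[OF po' i u x' x v] po_comm by simp
  then obtain \<theta> where \<theta>: "\<theta> \<in> homs E D' D" "\<theta> \<cdot> x' = x" "\<theta> \<cdot> j = v" by blast
  have \<theta>\<eta>: "\<theta> \<cdot> \<eta> = Idn E D"
  proof -
    have "\<exists>!h. h \<in> homs E D D \<and> h \<cdot> v = v \<and> h \<cdot> x = x" using po_univ[OF v x po_comm] .
    moreover have "\<theta> \<cdot> \<eta> \<in> homs E D D \<and> (\<theta> \<cdot> \<eta>) \<cdot> v = v \<and> (\<theta> \<cdot> \<eta>) \<cdot> x = x"
      using cmp_hom[OF \<eta>(1) \<theta>(1)] cmp_assoc[OF v \<eta>(1) \<theta>(1)] cmp_assoc[OF x \<eta>(1) \<theta>(1)] \<eta> \<theta>
      by simp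
    moreover have "Idn E D \<in> homs E D D \<and> Idn E D \<cdot> v = v \<and> Idn E D \<cdot> x = x"
      using idn_hom homs_obj(2)[OF v] idn_cmp[OF v] idn_cmp[OF x] by simp
    ultimately show ?thesis by blast
  qed
  \<comment> \<open>\<open>w\<close> is a cokernel of \<open>v\<close>, so \<open>c \<eta>\<close>, which vanishes on \<open>v\<close>, factors through it.\<close>
  obtain h where h: "h \<in> homs E (shift E A) (Tgt E c)" "h \<cdot> w = c \<cdot> \<eta>"
  proof -
    note c\<eta> = cmp_hom[OF \<eta>(1) c]
    have T: "Tgt E c \<in> Obj E" using homs_obj(2)[OF c] .
    have c\<eta>v: "(c \<cdot> \<eta>) \<cdot> v = Zer E B (Tgt E c)"
      using cmp_assoc[OF v \<eta>(1) c] \<eta>(2) cokernel_cmp[OF confl_cokernel[OF conf] j c] by simp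
    have c\<eta>x: "((c \<cdot> \<eta>) \<cdot> x) \<cdot> Inc E A = Zer E A (Tgt E c)"
      using cmp_assoc[OF i x c\<eta>] cmp_assoc[OF u v c\<eta>] c\<eta>v po_comm zer_cmp[OF u T] by simp
    obtain h where h: "h \<in> homs E (shift E A) (Tgt E c)" "h \<cdot> Prj E A = (c \<cdot> \<eta>) \<cdot> x"
      using cokernel_factor[OF prj_cokernel[OF ob(1)] i pr cmp_hom[OF x c\<eta>] c\<eta>x] by blast
    have hw: "(h \<cdot> w) \<cdot> v = (c \<cdot> \<eta>) \<cdot> v" "(h \<cdot> w) \<cdot> x = (c \<cdot> \<eta>) \<cdot> x"
      using cmp_assoc[OF v w h(1)] wv cmp_zer[OF h(1) ob(2)] c\<eta>v
        cmp_assoc[OF x w h(1)] wx h(2) by simp_all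
    have "((c \<cdot> \<eta>) \<cdot> v) \<cdot> u = ((c \<cdot> \<eta>) \<cdot> x) \<cdot> Inc E A"
      using cmp_assoc[OF i x c\<eta>] cmp_assoc[OF u v c\<eta>] po_comm by simp
    then have "h \<cdot> w = c \<cdot> \<eta>"
      using po_univ[OF cmp_hom[OF v c\<eta>] cmp_hom[OF x c\<eta>]] hw c\<eta> cmp_hom[OF w h(1)] by blast
    then show thesis using that h(1) by blast
  qed
  have ker: "is_kernel E c j" using confl_kernel[OF conf] .
  have "\<exists>!t. t \<in> homs E Y B \<and> v \<cdot> t = g"
    if Y: "Y \<in> Obj E" and g: "g \<in> homs E Y D" and wg: "w \<cdot> g = Zer E Y (shift E A)" for Y g
  proof -
    have "c \<cdot> (\<eta> \<cdot> g) = Zer E Y (Tgt E c)"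
      using cmp_assoc[OF g \<eta>(1) c] cmp_assoc[OF g w h(1)] h(2) wg cmp_zer[OF h(1) Y] by simp
    then obtain t where t: "t \<in> homs E Y B" "j \<cdot> t = \<eta> \<cdot> g"
      using kernel_factor[OF ker j c cmp_hom[OF g \<eta>(1)]] by blast
    have "v \<cdot> t = g"
      using cmp_assoc[OF t(1) j \<theta>(1)] \<theta>(3) t(2) cmp_assoc[OF g \<eta>(1) \<theta>(1)] \<theta>\<eta> idn_cmp[OF g]
      by simp
    moreover have "s = t" if s: "s \<in> homs E Y B" "v \<cdot> s = g" for s
    proof -
      have "j \<cdot> s = j \<cdot> t" using cmp_assoc[OF s(1) v \<eta>(1)] \<eta>(2) s(2) t(2) by simp
      then show ?thesis using kernel_mono[OF ker j c s(1) t(1)] by simp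
    qed
    ultimately show ?thesis using t(1) by blast
  qed
  moreover have "v \<in> Arr E" "w \<in> Arr E" "Src E v = B" "Tgt E v = D" "Src E w = D"
    "Tgt E w = shift E A"
    using v w by (simp_all add: homs_def)
  ultimately show ?thesis using wv unfolding is_kernel_def by simp
qed

lemma standard_triangle_zero:
  assumes u: "u \<in> homs E A B" and v: "v \<in> homs E B D" and x: "x \<in> homs E (hull E A) D"
    and po: "is_pushout E u (Inc E A) v x"
  shows "cls v \<cdot>\<^bsub>T\<^esub> cls u = Zer T A D"
proof -
  have A: "A \<in> Obj E" using homs_obj(1)[OF u] .
  have "v \<cdot> u = x \<cdot> Inc E A" using po by (simp add: is_pushout_def)
  then show ?thesis
    using stable_cmp[OF u v] cls_zero_if_factors[OF hull_projective[OF A] inc_hom[OF A] x] by simp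
qed

text \<open>If \<open>w f\<close> extends to \<open>I(Y)\<close>, the extension lifts through \<open>I(A) \<rightarrow> A[1]\<close>. Carrying the lift to
  \<open>D\<close> by \<open>x\<close> gives a null morphism that has the same composite with \<open>w\<close> as \<open>f\<close>, so it differs from \<open>f\<close>
  by a morphism through the kernel \<open>v\<close> of \<open>w\<close>.\<close>

lemma standard_triangle_exact:
  assumes A: "A \<in> Obj E" and v: "v \<in> homs E B D" and x: "x \<in> homs E (hull E A) D"
    and w: "w \<in> homs E D (shift E A)" and wx: "w \<cdot> x = Prj E A" and ker: "is_kernel E w v"
    and F: "F \<in> homs T Y D" and wF: "cls w \<cdot>\<^bsub>T\<^esub> F = Zer T Y (shift E A)"
  shows "\<exists>G \<in> homs T Y B. F = cls v \<cdot>\<^bsub>T\<^esub> G"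
proof -
  obtain f where f: "f \<in> homs E Y D" "F = cls f" using F by (rule stable_homE)
  note Y = homs_obj(1)[OF f(1)]
  note iY = inc_hom[OF Y]
  obtain h where h: "h \<in> homs E (hull E Y) (shift E A)" "w \<cdot> f = h \<cdot> Inc E Y"
    using cls_zero_iff[OF cmp_hom[OF f(1) w]] wF stable_cmp[OF f(1) w] f(2) by auto
  obtain y where y: "y \<in> homs E (hull E Y) (hull E A)" "Prj E A \<cdot> y = h"
    using hull_lift_shift[OF A Y h(1)] by blast
  note xy = cmp_hom[OF y(1) x]
  have "w \<cdot> f = w \<cdot> ((x \<cdot> y) \<cdot> Inc E Y)"
    using h(2) y(2) wx cmp_assoc[OF y(1) x w] cmp_assoc[OF iY xy w] by simp
  then obtain g where g: "g \<in> homs E Y B" "f = Add E (v \<cdot> g) ((x \<cdot> y) \<cdot> Inc E Y)"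
    using kernel_difference[OF ker v w f(1) cmp_hom[OF iY xy]] by blast
  have "f = Add E ((x \<cdot> y) \<cdot> Inc E Y) (v \<cdot> g)"
    using g add_commute[OF cmp_hom[OF g(1) v] cmp_hom[OF iY xy]] by simp
  then have "cls f = cls (v \<cdot> g)"
    using cls_eq_iff[OF f(1) cmp_hom[OF g(1) v]] xy by blast
  then show ?thesis using stable_cmp[OF g(1) v] f(2) cls_hom[OF g(1)] by metis
qed

text \<open>In the long exact sequence, a morphism \<open>R[1] \<rightarrow> D\<close> yields by composition with \<open>w\<close> the shift of a
  morphism \<open>z : R \<rightarrow> A\<close> with \<open>u z = 0\<close>. The proof constructs \<open>z\<close> explicitly; when \<open>u\<close> is
  injective on \<open>(R, -)\<close>, then \<open>z\<close>, and with it its shift, is stably zero.\<close>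

lemma standard_triangle_connecting_zero:
  assumes u: "u \<in> homs E A B" and v: "v \<in> homs E B D" and x: "x \<in> homs E (hull E A) D"
    and w: "w \<in> homs E D (shift E A)" and po: "is_pushout E u (Inc E A) v x"
    and wx: "w \<cdot> x = Prj E A" and ker: "is_kernel E w v"
    and R: "R \<in> Obj E"
    and inj: "\<And>Z. \<lbrakk>Z \<in> homs T R A; cls u \<cdot>\<^bsub>T\<^esub> Z = Zer T R B\<rbrakk> \<Longrightarrow> Z = Zer T R A"
    and F: "F \<in> homs T (shift E R) D"
  shows "cls w \<cdot>\<^bsub>T\<^esub> F = Zer T (shift E R) (shift E A)"
proof -
  obtain f where f: "f \<in> homs E (shift E R) D" "F = cls f" using F by (rule stable_homE)
  note ob = homs_obj[OF u]
  note iR = inc_hom[OF R] and pR = prj_hom[OF R] and iA = inc_hom[OF ob(1)] and pA = prj_hom[OF ob(1)]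
  note kA = inc_kernel[OF ob(1)] and cR = prj_cokernel[OF R]
  have po_comm: "v \<cdot> u = x \<cdot> Inc E A" using po by (simp add: is_pushout_def)
  note wf = cmp_hom[OF f(1) w] and fp = cmp_hom[OF pR f(1)]
  \<comment> \<open>Lift \<open>w f\<close> to a morphism \<open>(z, y, w f)\<close> from the hull conflation of \<open>R\<close> to that of \<open>A\<close>.\<close>
  obtain y where y: "y \<in> homs E (hull E R) (hull E A)" "Prj E A \<cdot> y = (w \<cdot> f) \<cdot> Prj E R"
    using hull_lift_shift[OF ob(1) R cmp_hom[OF pR wf]] by blast
  have prj_inc_R: "h \<cdot> (Prj E R \<cdot> Inc E R) = Zer E R Y" if "h \<in> homs E (shift E R) Y" for h Y
    using cokernel_cmp[OF cR iR pR] cmp_zer[OF that R] by simp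
  have "Prj E A \<cdot> (y \<cdot> Inc E R) = Zer E R (shift E A)"
    using cmp_assoc[OF iR y(1) pA] y(2) cmp_assoc[OF iR pR wf] prj_inc_R[OF wf] by simp
  then obtain z where z: "z \<in> homs E R A" "Inc E A \<cdot> z = y \<cdot> Inc E R"
    using kernel_factor[OF kA iA pA cmp_hom[OF iR y(1)]] by blast
  \<comment> \<open>On \<open>I(R)\<close>, \<open>f\<close> and \<open>x y\<close> agree after \<open>w\<close>, so they differ by some \<open>v t\<close>. Restricted to \<open>R\<close>,
    where \<open>f\<close> vanishes and \<open>x y\<close> becomes \<open>v u z\<close>, this shows that \<open>- t\<close> extends \<open>u z\<close> to \<open>I(R)\<close>.\<close>
  have xy: "x \<cdot> y \<in> homs E (hull E R) D" using cmp_hom[OF y(1) x] .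
  have "w \<cdot> (f \<cdot> Prj E R) = w \<cdot> (x \<cdot> y)"
    using cmp_assoc[OF pR f(1) w] y(2) wx cmp_assoc[OF y(1) x w] by simp
  then obtain t where t: "t \<in> homs E (hull E R) B" "f \<cdot> Prj E R = Add E (v \<cdot> t) (x \<cdot> y)"
    using kernel_difference[OF ker v w fp xy] by blast
  note vt = cmp_hom[OF t(1) v] and ti = cmp_hom[OF iR t(1)] and uz = cmp_hom[OF z(1) u]
  have "(x \<cdot> y) \<cdot> Inc E R = v \<cdot> (u \<cdot> z)"
    using cmp_assoc[OF iR y(1) x] z(2) cmp_assoc[OF z(1) iA x] cmp_assoc[OF z(1) u v] po_comm
    by simp
  then have "v \<cdot> Add E (t \<cdot> Inc E R) (u \<cdot> z) = (f \<cdot> Prj E R) \<cdot> Inc E R"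
    using t(2) cmp_add_left[OF iR vt xy] cmp_add_right[OF ti uz v] cmp_assoc[OF iR t(1) v] by simp
  also have "\<dots> = v \<cdot> Zer E R B"
    using cmp_assoc[OF iR pR f(1)] prj_inc_R[OF f(1)] cmp_zer[OF v R] by simp
  finally have "Add E (t \<cdot> Inc E R) (u \<cdot> z) = Zer E R B"
    using kernel_mono[OF ker v w add_hom[OF ti uz] zer_hom[OF R ob(2)]] by simp
  then have "cls (u \<cdot> z) = Zer T R B"
    using cls_eq_iff[OF zer_hom[OF R ob(2)] uz] t(1) stable_zer by metis
  then have "cls z = Zer T R A" using inj[OF cls_hom[OF z(1)]] stable_cmp[OF z(1) u] by simp
  then obtain s where s: "s \<in> homs E (hull E R) A" "z = s \<cdot> Inc E R"
    using cls_zero_iff[OF z(1)] by blast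
  \<comment> \<open>With \<open>z\<close> extended to the hull by \<open>s\<close>, subtracting \<open>s\<close> from \<open>y\<close> gives a map that vanishes on \<open>R\<close>,
    that is, a map \<open>q\<close> on \<open>R[1]\<close>; it lifts \<open>w f\<close> to the projective object \<open>I(A)\<close>.\<close>
  note iAs = cmp_hom[OF s(1) iA]
  have "y \<cdot> Inc E R = (Inc E A \<cdot> s) \<cdot> Inc E R"
    using z(2) s(2) cmp_assoc[OF iR s(1) iA] by simp
  then obtain q where q: "q \<in> homs E (shift E R) (hull E A)"
      "y = Add E (q \<cdot> Prj E R) (Inc E A \<cdot> s)"
    using cokernel_difference[OF cR iR pR y(1) iAs] by blast
  note qp = cmp_hom[OF pR q(1)] and pq = cmp_hom[OF q(1) pA]
  have "Prj E A \<cdot> (Inc E A \<cdot> s) = Zer E (hull E R) (shift E A)"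
    using cmp_assoc[OF s(1) iA pA] kernel_cmp[OF kA iA pA] zer_cmp[OF s(1) homs_obj(2)[OF pA]]
    by simp
  then have "Prj E A \<cdot> y = (Prj E A \<cdot> q) \<cdot> Prj E R"
    using q(2) cmp_add_right[OF qp iAs pA] cmp_assoc[OF pR q(1) pA]
      add_zer[OF cmp_hom[OF qp pA]] by simp
  then have "w \<cdot> f = Prj E A \<cdot> q"
    using cokernel_epi[OF cR iR pR wf pq] y(2) by simp
  then show ?thesis
    using cls_zero_if_factors[OF hull_projective[OF ob(1)] q(1) pA] stable_cmp[OF f(1) w] f(2)
    by simp
qed

text \<open>The second assertion combines the two previous lemmas: \<open>F\<close> is killed by the connecting map,
  so it comes from \<open>B\<close>. Lifting the transported morphism in the standard triangle and going back
  along \<open>\<beta>\<close> involves the squares of \<open>\<epsilon>\<close> and \<open>a\<close> alone, so no shift of a morphism is computed.\<close>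

lemma distinguished_triangle_lift:
  assumes dist: "distinguished E (\<epsilon>, a, b)"
    and \<epsilon>: "\<epsilon> \<in> homs T A B" and a: "a \<in> homs T B D" and b: "b \<in> homs T D (shift E A)"
  shows "a \<cdot>\<^bsub>T\<^esub> \<epsilon> = Zer T A D"
    and "\<And>R R' F. \<lbrakk>R' \<in> Obj E; isomorphic T (shift E R') R;
        \<And>Z. \<lbrakk>Z \<in> homs T R' A; \<epsilon> \<cdot>\<^bsub>T\<^esub> Z = Zer T R' B\<rbrakk> \<Longrightarrow> Z = Zer T R' A;
        F \<in> homs T R D\<rbrakk> \<Longrightarrow> \<exists>G \<in> homs T R B. a \<cdot>\<^bsub>T\<^esub> G = F"
proof -
  obtain s \<alpha> \<beta> \<gamma> where s: "standard_triangle E s" and mor: "triangle_morphism E s (\<epsilon>, a, b) \<alpha> \<beta> \<gamma>"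
    and iso: "isomorphism T \<alpha>" "isomorphism T \<beta>" "isomorphism T \<gamma>"
    using dist unfolding distinguished_def by blast
  obtain A' B' D' u v x w where u: "u \<in> homs E A' B'" and v: "v \<in> homs E B' D'"
    and x: "x \<in> homs E (hull E A') D'" and w: "w \<in> homs E D' (shift E A')"
    and po: "is_pushout E u (Inc E A') v x" and wx: "w \<cdot> x = Prj E A'"
    and wv: "w \<cdot> v = Zer E B' (shift E A')" and s_eq: "s = (cls u, cls v, cls w)"
    using s unfolding standard_triangle_def by blast
  note cu = cls_hom[OF u] and cv = cls_hom[OF v] and cw = cls_hom[OF w]
  note A' = homs_obj(1)[OF u]
  have \<alpha>: "\<alpha> \<in> homs T A' A" and \<beta>: "\<beta> \<in> homs T B' B" and \<gamma>: "\<gamma> \<in> homs T D' D"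
    and sq1: "\<beta> \<cdot>\<^bsub>T\<^esub> cls u = \<epsilon> \<cdot>\<^bsub>T\<^esub> \<alpha>" and sq2: "\<gamma> \<cdot>\<^bsub>T\<^esub> cls v = a \<cdot>\<^bsub>T\<^esub> \<beta>"
    using mor cu cv cw \<epsilon> a b unfolding s_eq triangle_morphism_def homs_def by auto
  obtain \<alpha>' where \<alpha>': "\<alpha>' \<in> homs T A A'" "\<alpha>' \<cdot>\<^bsub>T\<^esub> \<alpha> = Idn T A'" "\<alpha> \<cdot>\<^bsub>T\<^esub> \<alpha>' = Idn T A"
    using st.isomorphism_inverse[OF iso(1) \<alpha>] by blast
  obtain \<gamma>' where \<gamma>': "\<gamma>' \<in> homs T D D'" "\<gamma> \<cdot>\<^bsub>T\<^esub> \<gamma>' = Idn T D"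
    using st.isomorphism_inverse[OF iso(3) \<gamma>] by blast
  have ker: "is_kernel E w v" using standard_triangle_kernel[OF u v x w po wx wv] .
  show "a \<cdot>\<^bsub>T\<^esub> \<epsilon> = Zer T A D"
  proof -
    have "(a \<cdot>\<^bsub>T\<^esub> \<epsilon>) \<cdot>\<^bsub>T\<^esub> \<alpha> = (a \<cdot>\<^bsub>T\<^esub> \<beta>) \<cdot>\<^bsub>T\<^esub> cls u"
      using st.cmp_assoc[OF \<alpha> \<epsilon> a] st.cmp_assoc[OF cu \<beta> a] sq1 by simp
    also have "\<dots> = \<gamma> \<cdot>\<^bsub>T\<^esub> (cls v \<cdot>\<^bsub>T\<^esub> cls u)" using sq2 st.cmp_assoc[OF cu cv \<gamma>] by simp
    also have "\<dots> = Zer T A' D"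
      using standard_triangle_zero[OF u v x po] st.cmp_zer[OF \<gamma>] A' by simp
    finally have "((a \<cdot>\<^bsub>T\<^esub> \<epsilon>) \<cdot>\<^bsub>T\<^esub> \<alpha>) \<cdot>\<^bsub>T\<^esub> \<alpha>' = Zer T A D"
      using st.zer_cmp[OF \<alpha>'(1) st.homs_obj(2)[OF a]] by simp
    then show ?thesis
      using st.cmp_assoc[OF \<alpha>'(1) \<alpha> st.cmp_hom[OF \<epsilon> a]] \<alpha>'(3)
        st.cmp_idn[OF st.cmp_hom[OF \<epsilon> a]] by simp
  qed
  fix R R' F assume R': "R' \<in> Obj E" and isoR: "isomorphic T (shift E R') R"
    and inj: "\<And>Z. \<lbrakk>Z \<in> homs T R' A; \<epsilon> \<cdot>\<^bsub>T\<^esub> Z = Zer T R' B\<rbrakk> \<Longrightarrow> Z = Zer T R' A"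
    and F: "F \<in> homs T R D"
  obtain \<phi> where \<phi>: "\<phi> \<in> homs T (shift E R') R" and "isomorphism T \<phi>"
    using isoR unfolding isomorphic_def by blast
  then obtain \<psi> where \<psi>: "\<psi> \<in> homs T R (shift E R')" "\<phi> \<cdot>\<^bsub>T\<^esub> \<psi> = Idn T R"
    using st.isomorphism_inverse by blast
  have inj': "Z = Zer T R' A'" if Z: "Z \<in> homs T R' A'" and uZ: "cls u \<cdot>\<^bsub>T\<^esub> Z = Zer T R' B'" for Z
  proof -
    have "\<epsilon> \<cdot>\<^bsub>T\<^esub> (\<alpha> \<cdot>\<^bsub>T\<^esub> Z) = \<beta> \<cdot>\<^bsub>T\<^esub> (cls u \<cdot>\<^bsub>T\<^esub> Z)"
      using st.cmp_assoc[OF Z \<alpha> \<epsilon>] st.cmp_assoc[OF Z cu \<beta>] sq1 by simp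
    also have "\<dots> = Zer T R' B" using uZ st.cmp_zer[OF \<beta>] R' by simp
    finally have "\<alpha> \<cdot>\<^bsub>T\<^esub> Z = Zer T R' A" using inj st.cmp_hom[OF Z \<alpha>] by blast
    then show ?thesis
      using st.cmp_assoc[OF Z \<alpha> \<alpha>'(1)] \<alpha>'(2) st.idn_cmp[OF Z] st.cmp_zer[OF \<alpha>'(1)] R' by simp
  qed
  define H where "H = \<gamma>' \<cdot>\<^bsub>T\<^esub> F"
  have H: "H \<in> homs T R D'" unfolding H_def using st.cmp_hom[OF F \<gamma>'(1)] .
  note H\<phi> = st.cmp_hom[OF \<phi> H]
  have "cls w \<cdot>\<^bsub>T\<^esub> (H \<cdot>\<^bsub>T\<^esub> \<phi>) = Zer T (shift E R') (shift E A')"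
    using standard_triangle_connecting_zero[OF u v x w po wx ker R' inj' H\<phi>] .
  then have "(cls w \<cdot>\<^bsub>T\<^esub> (H \<cdot>\<^bsub>T\<^esub> \<phi>)) \<cdot>\<^bsub>T\<^esub> \<psi> = Zer T R (shift E A')"
    using st.zer_cmp[OF \<psi>(1)] shift_obj[OF A'] by simp
  moreover have "(H \<cdot>\<^bsub>T\<^esub> \<phi>) \<cdot>\<^bsub>T\<^esub> \<psi> = H"
    using st.cmp_assoc[OF \<psi>(1) \<phi> H] \<psi>(2) st.cmp_idn[OF H] by simp
  ultimately have "cls w \<cdot>\<^bsub>T\<^esub> H = Zer T R (shift E A')"
    using st.cmp_assoc[OF \<psi>(1) H\<phi> cw] by simp
  then obtain G where G: "G \<in> homs T R B'" "H = cls v \<cdot>\<^bsub>T\<^esub> G"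
    using standard_triangle_exact[OF A' v x w wx ker H] by blast
  have "a \<cdot>\<^bsub>T\<^esub> (\<beta> \<cdot>\<^bsub>T\<^esub> G) = \<gamma> \<cdot>\<^bsub>T\<^esub> H"
    using st.cmp_assoc[OF G(1) \<beta> a] st.cmp_assoc[OF G(1) cv \<gamma>] sq2 G(2) by simp
  also have "\<dots> = F"
    unfolding H_def using st.cmp_assoc[OF F \<gamma>'(1) \<gamma>] \<gamma>'(2) st.idn_cmp[OF F] by simp
  finally show "\<exists>G \<in> homs T R B. a \<cdot>\<^bsub>T\<^esub> G = F" using st.cmp_hom[OF G(1) \<beta>] by blast
qed

section \<open>Precovers\<close>

lemma precover_lift:
  assumes "precover E \<R> Y p" and "p \<in> homs E Q Y" and "R \<in> \<R>" and "f \<in> homs E R Y"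
  shows "\<exists>g \<in> homs E R Q. p \<cdot> g = f"
  using assms unfolding precover_def homs_def by auto

lemma precover_stable_surjective:
  assumes pre: "precover E \<R> Y p" and p: "p \<in> homs E Q Y"
    and R: "R \<in> \<R>" and F: "F \<in> homs T R Y"
  shows "\<exists>G \<in> homs T R Q. cls p \<cdot>\<^bsub>T\<^esub> G = F"
proof -
  obtain f where f: "f \<in> homs E R Y" "F = cls f" using F by (rule stable_homE)
  obtain g where g: "g \<in> homs E R Q" "p \<cdot> g = f" using precover_lift[OF pre p R f(1)] by blast
  then show ?thesis using stable_cmp[OF g(1) p] f(2) cls_hom[OF g(1)] by metis
qed

text \<open>If \<open>p f\<close> extends to the hull of \<open>R\<close>, the extension lifts through the precover because the hull
  is in the class. Subtracting the lift changes \<open>f\<close> by a null morphism and makes \<open>p f\<close> zero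
  on the nose.\<close>

lemma precover_stable_exact:
  assumes pre: "precover E \<R> Y p" and p: "p \<in> homs E Q Y"
    and ker: "is_kernel E p k" and k: "k \<in> homs E M Q" and hull: "hull E R \<in> \<R>"
    and G: "G \<in> homs T R Q" and zero: "cls p \<cdot>\<^bsub>T\<^esub> G = Zer T R Y"
  shows "\<exists>H \<in> homs T R M. G = cls k \<cdot>\<^bsub>T\<^esub> H"
proof -
  obtain f where f: "f \<in> homs E R Q" "G = cls f" using G by (rule stable_homE)
  note i = inc_hom[OF homs_obj(1)[OF f(1)]]
  obtain h where h: "h \<in> homs E (hull E R) Y" "p \<cdot> f = h \<cdot> Inc E R"
    using cls_zero_iff[OF cmp_hom[OF f(1) p]] zero f(2) stable_cmp[OF f(1) p] by auto
  obtain h' where h': "h' \<in> homs E (hull E R) Q" "p \<cdot> h' = h"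
    using precover_lift[OF pre p hull h(1)] by blast
  note hi = cmp_hom[OF i h'(1)]
  have "p \<cdot> f = p \<cdot> (h' \<cdot> Inc E R)" using cmp_assoc[OF i h'(1) p] h h' by simp
  then obtain m where m: "m \<in> homs E R M" "f = Add E (k \<cdot> m) (h' \<cdot> Inc E R)"
    using kernel_difference[OF ker k p f(1) hi] by blast
  note km = cmp_hom[OF m(1) k]
  have "cls f = cls (k \<cdot> m)"
    using cls_eq_iff[OF f(1) km] m(2) add_commute[OF km hi] h'(1) by metis
  then show ?thesis using stable_cmp[OF m(1) k] f(2) cls_hom[OF m(1)] by metis
qed

text \<open>If \<open>k m\<close> extends to \<open>h : I(R) \<rightarrow> Q\<close>, then \<open>p h\<close> vanishes on \<open>R\<close> and so comes from \<open>R[1]\<close>. As \<open>R[1]\<close> is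
  in the class, it can be lifted to \<open>Q\<close> and subtracted from \<open>h\<close> without changing \<open>h\<close> on \<open>R\<close>.
  The corrected \<open>h\<close> factors through \<open>k\<close>, and the factor extends \<open>m\<close> to \<open>I(R)\<close>.\<close>

lemma precover_kernel_stable_injective:
  assumes pre: "precover E \<R> Y p" and p: "p \<in> homs E Q Y"
    and ker: "is_kernel E p k" and k: "k \<in> homs E M Q" and shift: "shift E R \<in> \<R>"
    and F: "F \<in> homs T R M" and zero: "cls k \<cdot>\<^bsub>T\<^esub> F = Zer T R Q"
  shows "F = Zer T R M"
proof -
  obtain m where m: "m \<in> homs E R M" "F = cls m" using F by (rule stable_homE)
  note R = homs_obj(1)[OF m(1)]
  note i = inc_hom[OF R] and pr = prj_hom[OF R] and cok = prj_cokernel[OF R]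
  obtain h where h: "h \<in> homs E (hull E R) Q" "k \<cdot> m = h \<cdot> Inc E R"
    using cls_zero_iff[OF cmp_hom[OF m(1) k]] zero m(2) stable_cmp[OF m(1) k] by auto
  have "(p \<cdot> h) \<cdot> Inc E R = Zer E R Y"
    using cmp_assoc[OF i h(1) p] cmp_assoc[OF m(1) k p] h(2) kernel_cmp[OF ker k p]
      zer_cmp[OF m(1) homs_obj(2)[OF p]] by simp
  then obtain t where t: "t \<in> homs E (shift E R) Y" "t \<cdot> Prj E R = p \<cdot> h"
    using cokernel_factor[OF cok i pr cmp_hom[OF h(1) p]] by blast
  obtain s where s: "s \<in> homs E (shift E R) Q" "p \<cdot> s = t"
    using precover_lift[OF pre p shift t(1)] by blast
  note sp = cmp_hom[OF pr s(1)]
  have "p \<cdot> h = p \<cdot> (s \<cdot> Prj E R)" using cmp_assoc[OF pr s(1) p] s t by simp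
  then obtain n where n: "n \<in> homs E (hull E R) M" "h = Add E (k \<cdot> n) (s \<cdot> Prj E R)"
    using kernel_difference[OF ker k p h(1) sp] by blast
  note kn = cmp_hom[OF n(1) k]
  have "(s \<cdot> Prj E R) \<cdot> Inc E R = Zer E R Q"
    using cmp_assoc[OF i pr s(1)] cokernel_cmp[OF cok i pr] cmp_zer[OF s(1) R] by simp
  then have "k \<cdot> m = k \<cdot> (n \<cdot> Inc E R)"
    using h(2) n(2) cmp_add_left[OF i kn sp] add_zer[OF cmp_hom[OF i kn]]
      cmp_assoc[OF i n(1) k] by simp
  then have "m = n \<cdot> Inc E R"
    using kernel_mono[OF ker k p m(1) cmp_hom[OF i n(1)]] by blast
  then show ?thesis using cls_zero_iff[OF m(1)] n(1) m(2) by blast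
qed

section \<open>Homotopy approximation\<close>

definition iso_on_homs_from :: "'o set \<Rightarrow> 'o \<Rightarrow> 'o \<Rightarrow> 'm set \<Rightarrow> bool" where
  "iso_on_homs_from \<R> L Y l \<longleftrightarrow> l \<in> homs T L Y \<and>
     (\<forall>R \<in> \<R>. (\<forall>G \<in> homs T R Y. \<exists>F \<in> homs T R L. l \<cdot>\<^bsub>T\<^esub> F = G) \<and>
              (\<forall>F \<in> homs T R L. l \<cdot>\<^bsub>T\<^esub> F = Zer T R Y \<longrightarrow> F = Zer T R L))"

text \<open>Surjectivity holds because \<open>p\<close> already factors through \<open>l\<close>. For injectivity, a morphism \<open>F\<close>
  killed by \<open>l\<close> is first lifted along \<open>a\<close> to some \<open>G\<close>, which \<open>p\<close> kills; then \<open>G\<close> comes from \<open>M\<close>,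
  hence from \<open>L'\<close>, and \<open>F\<close> factors through \<open>a \<epsilon> = 0\<close>.\<close>

lemma iso_on_homs_from_step:
  assumes \<R>: "\<R> \<subseteq> Obj E" and shifts: "closed_under_shifts E \<R>"
    and hulls: "\<And>R. R \<in> \<R> \<Longrightarrow> hull E R \<in> \<R>"
    and pre: "precover E \<R> Y p" and p: "p \<in> homs E Q Y"
    and ker: "is_kernel E p k" and k: "k \<in> homs E M Q"
    and l': "iso_on_homs_from \<R> L' M l'"
    and dist: "distinguished E (cls k \<cdot>\<^bsub>T\<^esub> l', a, b)"
    and a: "a \<in> homs T Q L" and b: "b \<in> homs T L (shift E L')"
    and l: "l \<in> homs T L Y" and la: "l \<cdot>\<^bsub>T\<^esub> a = cls p"
  shows "iso_on_homs_from \<R> L Y l"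
proof -
  have hl': "l' \<in> homs T L' M"
    and surj': "\<And>R G. \<lbrakk>R \<in> \<R>; G \<in> homs T R M\<rbrakk> \<Longrightarrow> \<exists>F \<in> homs T R L'. l' \<cdot>\<^bsub>T\<^esub> F = G"
    and inj': "\<And>R F. \<lbrakk>R \<in> \<R>; F \<in> homs T R L'; l' \<cdot>\<^bsub>T\<^esub> F = Zer T R M\<rbrakk> \<Longrightarrow> F = Zer T R L'"
    using l' unfolding iso_on_homs_from_def by blast+
  note ck = cls_hom[OF k] and \<epsilon> = st.cmp_hom[OF hl' cls_hom[OF k]]
  note tri = distinguished_triangle_lift[OF dist \<epsilon> a b]
  show ?thesis
    unfolding iso_on_homs_from_def
  proof (intro conjI l ballI impI)
    fix R G assume R: "R \<in> \<R>" and G: "G \<in> homs T R Y"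
    obtain H where H: "H \<in> homs T R Q" "cls p \<cdot>\<^bsub>T\<^esub> H = G"
      using precover_stable_surjective[OF pre p R G] by blast
    then have "l \<cdot>\<^bsub>T\<^esub> (a \<cdot>\<^bsub>T\<^esub> H) = G" using st.cmp_assoc[OF H(1) a l] la by simp
    then show "\<exists>F \<in> homs T R L. l \<cdot>\<^bsub>T\<^esub> F = G" using st.cmp_hom[OF H(1) a] by blast
  next
    fix R F assume R: "R \<in> \<R>" and F: "F \<in> homs T R L" and lF: "l \<cdot>\<^bsub>T\<^esub> F = Zer T R Y"
    have \<epsilon>_inj: "Z = Zer T S L'"
      if S: "S \<in> \<R>" and Z: "Z \<in> homs T S L'"
        and zero: "(cls k \<cdot>\<^bsub>T\<^esub> l') \<cdot>\<^bsub>T\<^esub> Z = Zer T S Q" for S Z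
    proof -
      have "shift E S \<in> \<R>" using shifts S unfolding closed_under_shifts_def by blast
      then have "l' \<cdot>\<^bsub>T\<^esub> Z = Zer T S M"
        using precover_kernel_stable_injective[OF pre p ker k _ st.cmp_hom[OF Z hl']]
          st.cmp_assoc[OF Z hl' ck] zero by simp
      then show ?thesis using inj'[OF S Z] by blast
    qed
    obtain R' where R': "R' \<in> \<R>" "isomorphic T (shift E R') R"
      using shifts R unfolding closed_under_shifts_def by blast
    obtain G where G: "G \<in> homs T R Q" "a \<cdot>\<^bsub>T\<^esub> G = F"
      using tri(2)[OF _ R'(2) \<epsilon>_inj[OF R'(1)] F] R'(1) \<R> by blast
    have "cls p \<cdot>\<^bsub>T\<^esub> G = Zer T R Y" using st.cmp_assoc[OF G(1) a l] la G(2) lF by simp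
    then obtain H where H: "H \<in> homs T R M" "G = cls k \<cdot>\<^bsub>T\<^esub> H"
      using precover_stable_exact[OF pre p ker k hulls[OF R] G(1)] by blast
    obtain N where N: "N \<in> homs T R L'" "l' \<cdot>\<^bsub>T\<^esub> N = H" using surj'[OF R H(1)] by blast
    have "F = (a \<cdot>\<^bsub>T\<^esub> (cls k \<cdot>\<^bsub>T\<^esub> l')) \<cdot>\<^bsub>T\<^esub> N"
      using st.cmp_assoc[OF N(1) \<epsilon> a] st.cmp_assoc[OF N(1) hl' ck] N(2) H(2) G(2) by simp
    then show "F = Zer T R L" using tri(1) st.zer_cmp[OF N(1) st.homs_obj(2)[OF a]] by simp
  qed
qed

lemma homotopy_approximation_iso_on_homs:
  assumes \<R>: "\<R> \<subseteq> Obj E" and shifts: "closed_under_shifts E \<R>"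
    and hulls: "\<And>R. R \<in> \<R> \<Longrightarrow> hull E R \<in> \<R>"
    and res: "resolution E \<R> X d K Rs p k"
    and approx: "homotopy_approximation E d K Rs p k L l"
    and i: "i \<le> d"
  shows "iso_on_homs_from \<R> (L i) (K i) (l i)"
  using i
proof (induction i rule: inc_induct)
  case base
  have "K d \<in> Obj T" "L d = K d" "l d = Idn T (K d)"
    using res approx \<R> by (auto simp: resolution_def homotopy_approximation_def)
  then show ?case
    unfolding iso_on_homs_from_def using st.idn_hom st.idn_cmp by auto
next
  case (step i)
  have p: "p i \<in> homs E (Rs i) (K i)" and pre: "precover E \<R> (K i) (p i)"
    and k: "k i \<in> homs E (K (Suc i)) (Rs i)" and ker: "is_kernel E (p i) (k i)"
    using res \<open>i < d\<close> by (auto simp: resolution_def)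
  obtain a b Z where
    a: "a \<in> homs T (Rs i) (L i)" and b: "b \<in> homs T (L i) (shift E (L (Suc i)))"
    and dist: "distinguished E (cls (k i) \<cdot>\<^bsub>T\<^esub> l (Suc i), a, b)"
    and l: "l i \<in> homs T (L i) (K i)"
    and mor: "triangle_morphism E (cls (k i) \<cdot>\<^bsub>T\<^esub> l (Suc i), a, b)
          (Zer T Z (K i), Idn T (K i), Zer T (K i) (shift E Z))
          (Zer T (L (Suc i)) Z) (cls (p i)) (l i)"
    using approx \<open>i < d\<close> unfolding homotopy_approximation_def by blast
  have "l i \<cdot>\<^bsub>T\<^esub> a = Idn T (K i) \<cdot>\<^bsub>T\<^esub> cls (p i)"
    using mor unfolding triangle_morphism_def by simp
  then have "l i \<cdot>\<^bsub>T\<^esub> a = cls (p i)" using st.idn_cmp[OF cls_hom[OF p]] by simp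
  then show ?case
    using iso_on_homs_from_step[OF \<R> shifts hulls pre p ker k step.IH dist a b l] by blast
qed

end

theorem theorem2p3:
  fixes E :: "('o, 'm, 'z) hulled_data_scheme"
    and \<R> :: "'o set" and X :: 'o and d :: nat
    and K Rs L :: "nat \<Rightarrow> 'o" and p k :: "nat \<Rightarrow> 'm" and l :: "nat \<Rightarrow> 'm set"
  assumes "frobenius_category E"
    and "injective_hulls E"
    and "\<R> \<subseteq> Obj E"
    and "precovering E \<R>"
    and "\<And>Y q. \<lbrakk>Y \<in> Obj E; precover E \<R> Y q\<rbrakk> \<Longrightarrow> \<exists>j. is_kernel E q j"
    and "closed_under_shifts E \<R>"
    and "\<And>R. R \<in> \<R> \<Longrightarrow> hull E R \<in> \<R>"
    and "X \<in> Obj E"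
    and "has_dimension E \<R> X d"
    and "resolution E \<R> X d K Rs p k"
    and "homotopy_approximation E d K Rs p k L l"
  shows "\<forall>R \<in> \<R>. (\<lambda>f. l 0 \<cdot>\<^bsub>stable E\<^esub> f)
                    \<in> iso (hom_group (stable E) R (L 0)) (hom_group (stable E) R X)"
proof
  interpret hulled_frobenius_category E
    using assms(1,2)
    by (simp add: hulled_frobenius_category_def hulled_frobenius_category_axioms_def)
  fix R assume R: "R \<in> \<R>"
  have K0: "K 0 = X" using assms(10) by (simp add: resolution_def)
  have iso: "iso_on_homs_from \<R> (L 0) X (l 0)"
    using homotopy_approximation_iso_on_homs[OF assms(3,6,7,10,11), of 0] K0 by simp
  show "(\<lambda>f. l 0 \<cdot>\<^bsub>stable E\<^esub> f)
      \<in> iso (hom_group (stable E) R (L 0)) (hom_group (stable E) R X)"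
  proof (rule st.cmp_iso_hom_group)
    show "l 0 \<in> homs T (L 0) X" using iso unfolding iso_on_homs_from_def by blast
    show "R \<in> Obj T" using R assms(3) by auto
  qed (use iso R in \<open>auto simp: iso_on_homs_from_def\<close>)
qed

end
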